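(* Let $n\ge 1$, let $B$ be a finite set with $|B|=m$, and let $d_0:B\times B\to\mathbb{N}$. Consider the problem of finding a graph $(X,E)$ with $|X|=n$, $B\subset X$ and $d_E|_{B\times B}=d_0$. Let $N=n(n-1)/2$ and identify $\{0,1\}^N$ with the set of graphs on $X=\{1,\dots,n\}$ (with $B=\{1,\dots,m\}$) via adjacency vectors $\vec e=(e(j,k))_{1\le j<k\le n}$; let $T\subset\{0,1\}^N$ be the set of $\vec e$ whose graph is a solution. Consider the following algorithm $\mathcal{A}$: for $L=0,1,2$, run GROVER-$L$ and, if the measured $\vec e$ is (classically verified to be) a solution, output it and halt; then for $K=2^{N-4},2^{N-5},\dots,2,1$, let $\theta\in(0,\pi/2)$ satisfy $\sin\theta=\sqrt{K/2^N}$, set $L=L(\theta)$, run GROVER-$L$ and, if the measured $\vec e$ is a solution, output it and halt; finally output "no solution found". Then: (1) If $\mathcal{A}$ outputs a vector $\vec e$, then the graph $(X,E)$ with edge set specified by $\vec e$ satisfies $d_E(x,y)=d_0(x,y)$ for all $x,y\in B$. Moreover, let $\delta\in(0,1)$ and let $M>\log_2(\delta^{-1})$ be an integer. If the problem admits a solution, then: (2) with probability at least $1/2$, $\mathcal{A}$ finds a solution using $$O\Big(2^{N/2}\Big(\tfrac1e\big(N^{1/2}-m\big)\Big)^{-(N^{1/2}-m)/2}\Big)$$ queries to the quantum oracle $O_T$ and to the classical solution-checking procedure; (3) if $\mathcal{A}$ is applied $M$ times, at least one solution is found with probability greater than $1-\delta$. Furthermore, the quantum oracle $O_T$ can be implemented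 with $O(N)=O(n^2)$ qubits and $O(mn^3)$ gates from the set $\{\mathrm{NOT},\mathrm{CNOT},\mathrm{CCNOT}\}$.
   Context: Graph distance $d_E(x,y)$ on a simple undirected graph is the minimal number of edges of a path from $x$ to $y$ ($\infty$ if none). A quantum oracle for $T\subset\{0,1\}^N$ is a unitary circuit acting on computational basis states as $|x\rangle\otimes|r\rangle\otimes|0\rangle_k\mapsto|x\rangle\otimes|r+f(x)\bmod 2\rangle\otimes|0\rangle_k$, where $f(x)=1$ if $x\in T$ and $0$ otherwise, and $|0\rangle_k$ are $k$ ancilla qubits. Let $|\gamma_N\rangle=2^{-N/2}\sum_{x\in\{0,1\}^N}|x\rangle$ and $D_N=2|\gamma_N\rangle\langle\gamma_N|-\mathrm{id}^{\otimes N}$ (diffusion operator). GROVER-$L$: initialize all qubits to $|0\rangle$, apply NOT to the target qubit $r$, apply a Hadamard gate to each of the $N$ adjacency qubits and to $r$, then $L$ times apply the oracle $O_T$ followed by $D_N$ on the $N$ adjacency qubits, then measure the $N$ adjacency qubits in the computational basis to obtain $\vec e$. The function $L(\theta)$ is $\lceil \pi/(4\theta)-1/2\rceil$ if $0<\theta<\pi/8$, $1$ if $\pi/8\le\theta<\pi/4$, and $0$ if $\pi/4\le\theta<\pi/2$. Checking whether a measured $\vec e$ is a solution is done by a classical algorithm computing graph distances between vertices of $B$.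
   Formalization: When N^{1/2} ≤ m the power in the query bound is undefined; there that factor is taken to be 1. The gate bound O(mn^3) is claimed for m ≥ 1 (at m = 0 a NOT is still needed), and the qubit bound O(N) for n ≥ 2 (N = 0 at n = 1), with O(n^2) for all n ≥ 1. *)

theory Defs
  imports "HOL-Probability.Probability"
begin


definition simple_graph :: "'v set \<Rightarrow> 'v set set \<Rightarrow> bool" where
  "simple_graph X E \<longleftrightarrow> E \<subseteq> {{x, y} |x y. x \<in> X \<and> y \<in> X \<and> x \<noteq> y}"

text \<open>A path is given by its nonempty list of vertices; it has \<open>length p - 1\<close> edges.\<close>
definition is_path :: "'v set \<Rightarrow> 'v set set \<Rightarrow> 'v \<Rightarrow> 'v list \<Rightarrow> 'v \<Rightarrow> bool" where
  "is_path X E x p y \<longleftrightarrow>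
     p \<noteq> [] \<and> hd p = x \<and> last p = y \<and> set p \<subseteq> X \<and> distinct p \<and>
     (\<forall>i. Suc i < length p \<longrightarrow> {p ! i, p ! Suc i} \<in> E)"

text \<open>If there is no path this is \<open>Inf {} = \<infinity>\<close>.\<close>
definition graph_dist :: "'v set \<Rightarrow> 'v set set \<Rightarrow> 'v \<Rightarrow> 'v \<Rightarrow> enat" where
  "graph_dist X E x y = Inf {enat (length p - 1) |p. is_path X E x p y}"

definition is_solution ::
  "'v set \<Rightarrow> ('v \<Rightarrow> 'v \<Rightarrow> nat) \<Rightarrow> 'v set \<Rightarrow> 'v set set \<Rightarrow> bool" where
  "is_solution B d0 X E \<longleftrightarrow>
     B \<subseteq> X \<and> simple_graph X E \<and> (\<forall>x\<in>B. \<forall>y\<in>B. graph_dist X E x y = enat (d0 x y))"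

definition admits_solution :: "nat \<Rightarrow> nat \<Rightarrow> (nat \<Rightarrow> nat \<Rightarrow> nat) \<Rightarrow> bool" where
  "admits_solution n m d0 \<longleftrightarrow>
     (\<exists>X E. finite X \<and> card X = n \<and> is_solution {1..m} d0 X E)"



definition num_pairs :: "nat \<Rightarrow> nat" where
  "num_pairs n = n * (n - 1) div 2"

definition vertex_pairs :: "nat \<Rightarrow> (nat \<times> nat) list" where
  "vertex_pairs n = concat (map (\<lambda>j. map (\<lambda>k. (j, k)) [Suc j..<Suc n]) [1..<Suc n])"

text \<open>Bit \<open>i\<close> of an adjacency vector is \<open>e(j,k)\<close>, where \<open>(j,k)\<close>, \<open>1 \<le> j < k \<le> n\<close>,
  is the \<open>i\<close>-th pair in lexicographic order.\<close>
definition edges_of :: "nat \<Rightarrow> bool list \<Rightarrow> nat set set" where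
  "edges_of n e =
     {{fst (vertex_pairs n ! i), snd (vertex_pairs n ! i)} |i. i < length (vertex_pairs n) \<and> e ! i}"

text \<open>The set \<open>{0,1}\<^sup>N\<close>, which also labels the computational basis of \<open>N\<close> qubits.\<close>
definition bitstrings :: "nat \<Rightarrow> bool list set" where
  "bitstrings N = {b. length b = N}"

definition solutions :: "nat \<Rightarrow> nat \<Rightarrow> (nat \<Rightarrow> nat \<Rightarrow> nat) \<Rightarrow> bool list set" where
  "solutions n m d0 = {e \<in> bitstrings (num_pairs n). is_solution {1..m} d0 {1..n} (edges_of n e)}"

definition classical_check :: "nat \<Rightarrow> nat \<Rightarrow> (nat \<Rightarrow> nat \<Rightarrow> nat) \<Rightarrow> bool list \<Rightarrow> bool" where
  "classical_check n m d0 e \<longleftrightarrow>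
     (\<forall>x\<in>{1..m}. \<forall>y\<in>{1..m}. graph_dist {1..n} (edges_of n e) x y = enat (d0 x y))"



text \<open>A state of \<open>q\<close> qubits is its family of amplitudes, supported on \<open>bitstrings q\<close>.
  An operator \<open>A\<close> on \<open>q\<close> qubits is its matrix in the computational basis:
  \<open>A b c\<close> is the entry in row \<open>b\<close>, column \<open>c\<close>, and only entries
  with \<open>b, c \<in> bitstrings q\<close> matter.\<close>
type_synonym qstate = "bool list \<Rightarrow> complex"
type_synonym qop = "bool list \<Rightarrow> bool list \<Rightarrow> complex"

definition ket :: "bool list \<Rightarrow> qstate" where
  "ket c = (\<lambda>b. if b = c then 1 else 0)"

definition app_op :: "nat \<Rightarrow> qop \<Rightarrow> qstate \<Rightarrow> qstate" where
  "app_op q A \<psi> = (\<lambda>b. if b \<in> bitstrings q then (\<Sum>c\<in>bitstrings q. A b c * \<psi> c) else 0)"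

definition id_op :: qop where
  "id_op b c = (if b = c then 1 else 0)"

definition mult_op :: "nat \<Rightarrow> qop \<Rightarrow> qop \<Rightarrow> qop" where
  "mult_op q A B b c = (\<Sum>d\<in>bitstrings q. A b d * B d c)"

definition adjoint_op :: "qop \<Rightarrow> qop" where
  "adjoint_op A b c = cnj (A c b)"

definition unitary_op :: "nat \<Rightarrow> qop \<Rightarrow> bool" where
  "unitary_op q U \<longleftrightarrow>
     (\<forall>b\<in>bitstrings q. \<forall>c\<in>bitstrings q.
        mult_op q (adjoint_op U) U b c = id_op b c \<and> mult_op q U (adjoint_op U) b c = id_op b c)"

text \<open>\<open>A \<otimes> id\<close>, with \<open>A\<close> acting on the first \<open>N\<close> qubits.\<close>
definition on_first :: "nat \<Rightarrow> qop \<Rightarrow> qop" where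
  "on_first N A b c = A (take N b) (take N c) * id_op (drop N b) (drop N c)"

definition hadamard :: "nat \<Rightarrow> qop" where
  "hadamard i b c =
     (if b[i := c ! i] = c then (if b ! i \<and> c ! i then - 1 else 1) / complex_of_real (sqrt 2) else 0)"

datatype rgate = NOT nat | CNOT nat nat | CCNOT nat nat nat

text \<open>The last index is the target, the others are the controls.\<close>
fun gate_map :: "rgate \<Rightarrow> bool list \<Rightarrow> bool list" where
  "gate_map (NOT t) b = b[t := (\<not> b ! t)]"
| "gate_map (CNOT c t) b = b[t := (b ! t \<noteq> b ! c)]"
| "gate_map (CCNOT c1 c2 t) b = b[t := (b ! t \<noteq> (b ! c1 \<and> b ! c2))]"

fun gate_wf :: "nat \<Rightarrow> rgate \<Rightarrow> bool" where
  "gate_wf q (NOT t) \<longleftrightarrow> t < q"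
| "gate_wf q (CNOT c t) \<longleftrightarrow> c < q \<and> t < q \<and> c \<noteq> t"
| "gate_wf q (CCNOT c1 c2 t) \<longleftrightarrow>
     c1 < q \<and> c2 < q \<and> t < q \<and> c1 \<noteq> c2 \<and> c1 \<noteq> t \<and> c2 \<noteq> t"

definition gate_op :: "rgate \<Rightarrow> qop" where
  "gate_op g b c = (if b = gate_map g c then 1 else 0)"

text \<open>The head of the list is the gate applied first.\<close>
fun circuit_op :: "nat \<Rightarrow> rgate list \<Rightarrow> qop" where
  "circuit_op q [] = id_op"
| "circuit_op q (g # gs) = mult_op q (circuit_op q gs) (gate_op g)"

text \<open>Register layout: qubits \<open>0, \<dots>, N - 1\<close> are the adjacency qubits, qubit \<open>N\<close> is the
  target qubit \<open>r\<close>, and the last \<open>k\<close> qubits are ancillas. The action of an oracle is only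
  prescribed where all ancillas are \<open>0\<close>.\<close>
definition quantum_oracle :: "nat \<Rightarrow> bool list set \<Rightarrow> nat \<Rightarrow> qop \<Rightarrow> bool" where
  "quantum_oracle N T k U \<longleftrightarrow>
     unitary_op (N + 1 + k) U \<and>
     (\<forall>x\<in>bitstrings N. \<forall>r.
        app_op (N + 1 + k) U (ket (x @ [r] @ replicate k False)) =
        ket (x @ [r \<noteq> (x \<in> T)] @ replicate k False))"



definition uniform_state :: "nat \<Rightarrow> qstate" where
  "uniform_state N =
     (\<lambda>b. complex_of_real (2 powr (- (real N / 2))) * (\<Sum>x\<in>bitstrings N. ket x b))"

definition diffusion :: "nat \<Rightarrow> qop" where
  "diffusion N b c = 2 * (uniform_state N b * cnj (uniform_state N c)) - id_op b c"

definition grover_init :: "nat \<Rightarrow> nat \<Rightarrow> qstate" where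
  "grover_init N k =
     (let q = N + 1 + k in
      fold (\<lambda>i. app_op q (hadamard i)) [0..<Suc N]
        (app_op q (gate_op (NOT N)) (ket (replicate q False))))"

definition grover_state :: "nat \<Rightarrow> nat \<Rightarrow> qop \<Rightarrow> nat \<Rightarrow> qstate" where
  "grover_state N k U L =
     (let q = N + 1 + k in
      ((\<lambda>\<psi>. app_op q (on_first N (diffusion N)) (app_op q U \<psi>)) ^^ L) (grover_init N k))"

text \<open>Born rule for measuring the first \<open>N\<close> of \<open>q\<close> qubits of a normalised state.\<close>
definition measure_first :: "nat \<Rightarrow> nat \<Rightarrow> qstate \<Rightarrow> bool list pmf" where
  "measure_first N q \<psi> =
     embed_pmf (\<lambda>e. \<Sum>b\<in>{b \<in> bitstrings q. take N b = e}. (cmod (\<psi> b))\<^sup>2)"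

definition grover :: "nat \<Rightarrow> nat \<Rightarrow> qop \<Rightarrow> nat \<Rightarrow> bool list pmf" where
  "grover N k U L = measure_first N (N + 1 + k) (grover_state N k U L)"

definition L_of_angle :: "real \<Rightarrow> nat" where
  "L_of_angle \<theta> =
     (if 0 < \<theta> \<and> \<theta> < pi / 8 then nat \<lceil>pi / (4 * \<theta>) - 1 / 2\<rceil>
      else if pi / 8 \<le> \<theta> \<and> \<theta> < pi / 4 then 1
      else 0)"

definition angle :: "nat \<Rightarrow> nat \<Rightarrow> real" where
  "angle N K = (THE \<theta>. 0 < \<theta> \<and> \<theta> < pi / 2 \<and> sin \<theta> = sqrt (real K / 2 ^ N))"

text \<open>The successive values of \<open>L\<close>. The numbers \<open>K = 2\<^bsup>N-4\<^esup>, \<dots>, 2, 1\<close> form the empty list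
  if \<open>N < 4\<close>.\<close>
definition schedule :: "nat \<Rightarrow> nat list" where
  "schedule N =
     [0, 1, 2] @ map (\<lambda>K. L_of_angle (angle N K)) (map (\<lambda>i. 2 ^ i) (rev [0..<N - 3]))"

text \<open>Result of a run: the output (\<open>None\<close> for ``no solution found''), the number of queries to the
  quantum oracle, and the number of calls of the classical check.\<close>
type_synonym run = "bool list option \<times> nat \<times> nat"

fun search_loop ::
  "(nat \<Rightarrow> bool list pmf) \<Rightarrow> (bool list \<Rightarrow> bool) \<Rightarrow> nat list \<Rightarrow> nat \<Rightarrow> nat \<Rightarrow> run pmf" where
  "search_loop G check [] a c = return_pmf (None, a, c)"
| "search_loop G check (L # Ls) a c =
     bind_pmf (G L) (\<lambda>e.
       if check e then return_pmf (Some e, a + L, c + 1)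
       else search_loop G check Ls (a + L) (c + 1))"

definition algorithm_A ::
  "nat \<Rightarrow> nat \<Rightarrow> (nat \<Rightarrow> nat \<Rightarrow> nat) \<Rightarrow> nat \<Rightarrow> qop \<Rightarrow> run pmf" where
  "algorithm_A n m d0 k U =
     search_loop (grover (num_pairs n) k U) (classical_check n m d0) (schedule (num_pairs n)) 0 0"

definition finds_solution :: "nat \<Rightarrow> nat \<Rightarrow> (nat \<Rightarrow> nat \<Rightarrow> nat) \<Rightarrow> run \<Rightarrow> bool" where
  "finds_solution n m d0 \<omega> \<longleftrightarrow> (\<exists>e \<in> solutions n m d0. fst \<omega> = Some e)"

definition queries :: "run \<Rightarrow> nat" where
  "queries \<omega> = fst (snd \<omega>) + snd (snd \<omega>)"

text \<open>The expression \<open>2\<^bsup>N/2\<^esup> (x/e)\<^bsup>-x/2\<^esup>\<close> with \<open>x = N\<^bsup>1/2\<^esup> - m\<close>. The second factor tends to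
  \<open>1\<close> as \<open>x\<close> decreases to \<open>0\<close>; for \<open>x \<le> 0\<close>, where the real power is not
  meaningful (and \<open>powr\<close> yields unrelated values), it is replaced by \<open>1\<close>.\<close>
definition query_rate :: "nat \<Rightarrow> nat \<Rightarrow> real" where
  "query_rate N m =
     (let x = sqrt (real N) - real m in
      2 powr (real N / 2) * (if x > 0 then (x / exp 1) powr (- (x / 2)) else 1))"

end

theory Submission
  imports Defs "HOL-Combinatorics.Permutations"
begin

text \<open>If \<open>t\<close> of the \<open>2\<^sup>N\<close> strings are solutions, then \<open>L\<close> Grover iterations produce a solution
  with probability \<open>sin\<^sup>2 ((2L + 1) \<theta>)\<close>, where \<open>sin\<^sup>2 \<theta> = t / 2\<^sup>N\<close>. Some entry of the schedule is
  close enough to the optimal \<open>L\<close> to succeed with probability at least \<open>1/2\<close>, and since the values of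
  \<open>L\<close> grow geometrically, the queries up to it number \<open>O((2\<^sup>N / t)\<^bsup>1/2\<^esup>)\<close>. Relabelling the
  vertices outside \<open>B\<close> of one solution, and redrawing the edges that do not affect distances to \<open>B\<close>, yields
  \<open>t \<ge> (n - m)!\<close>, and \<open>(n - m)! \<ge> (x/e)\<^sup>x\<close> for \<open>0 < x \<le> n - m\<close>. The oracle runs a breadth-first search
  from each terminal in turn, uncomputing its \<open>O(n\<^sup>2)\<close> ancillas before the next one.\<close>

section \<open>Graph distances\<close>

text \<open>An oracle is prescribed only on clean ancillas, so little is known of it as an operator.
  This suffices because every Grover iterate is a \<open>kickback_state\<close>: it vanishes where
  an ancilla is \<open>1\<close>, its target is in the state \<open>(|0> - |1>) / sqrt 2\<close>,
  and the oracle merely changes its sign on \<open>T\<close>. Two real amplitudes, one on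
  \<open>T\<close> and one off it, then describe the iterate completely.

  The rounds before the good one need no success estimate of their own: since the check is exact,
  such a round halts with a solution, below the query budget, or passes on. The loop inherits the
  success probability of the good round.

  The oracle tests distances by the thresholds \<open>l < n\<close>. These decide equality with
  \<open>d0\<close> if all its values are below \<open>n\<close>, as is every finite distance on
  \<open>n\<close> vertices; otherwise \<open>T\<close> is empty and the empty circuit
  serves.\<close>

lemma is_path_imp_le_potential:
  fixes D :: "'v \<Rightarrow> enat"
  assumes "\<And>u v. {u, v} \<in> E \<Longrightarrow> u \<in> X \<Longrightarrow> v \<in> X \<Longrightarrow> D v \<le> D u + 1"
    and "is_path X E x p y"
  shows "D y \<le> D x + enat (length p - 1)"
proof -
  have nth: "D (p ! i) \<le> D x + enat i" if "i < length p" for i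
    using that
  proof (induction i)
    case 0
    then show ?case using assms(2) by (simp add: is_path_def hd_conv_nth zero_enat_def[symmetric])
  next
    case (Suc i)
    have "D (p ! Suc i) \<le> D (p ! i) + 1"
      using Suc.prems assms(2) by (intro assms(1)) (auto simp: is_path_def)
    also have "\<dots> \<le> D x + enat i + 1"
      using Suc by (intro add_right_mono) auto
    finally show ?case by (simp add: add.assoc one_enat_def)
  qed
  show ?thesis
    using nth[of "length p - 1"] assms(2) by (auto simp: is_path_def last_conv_nth)
qed

lemma graph_dist_attained:
  assumes "graph_dist X E x y = enat l"
  obtains p where "is_path X E x p y" "length p = Suc l"
proof -
  let ?S = "{enat (length p - 1) |p. is_path X E x p y}"
  have "?S \<noteq> {}"
  proof
    assume "?S = {}"
    then show False using assms unfolding graph_dist_def by (simp only:) (simp add: top_enat_def)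
  qed
  then have "Inf ?S \<in> ?S" by (metis (no_types, lifting) Inf_enat_def LeastI ex_in_conv)
  then obtain p where p: "is_path X E x p y" "enat l = enat (length p - 1)"
    using assms unfolding graph_dist_def by auto
  then show ?thesis using that[of p] by (cases p) (auto simp: is_path_def)
qed

lemma graph_dist_le:
  "is_path X E x p y \<Longrightarrow> graph_dist X E x y \<le> enat (length p - 1)"
  unfolding graph_dist_def by (auto intro: Inf_lower)

lemma graph_dist_least:
  fixes D :: "'v \<Rightarrow> enat"
  assumes "\<And>u v. {u, v} \<in> E \<Longrightarrow> u \<in> X \<Longrightarrow> v \<in> X \<Longrightarrow> D v \<le> D u + 1" and "D x = 0"
  shows "D y \<le> graph_dist X E x y"
proof -
  have "D y \<le> enat (length p - 1)" if "is_path X E x p y" for p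
    using is_path_imp_le_potential[where D = D, OF assms(1) that] assms(2) by simp
  then show ?thesis unfolding graph_dist_def by (blast intro: Inf_greatest)
qed

lemma is_path_snoc:
  assumes "is_path X E x p u" "{u, v} \<in> E" "v \<in> X" "v \<notin> set p"
  shows "is_path X E x (p @ [v]) v"
  unfolding is_path_def
proof (intro conjI allI impI)
  fix i assume "Suc i < length (p @ [v])"
  then consider "Suc i < length p" | "Suc i = length p" by fastforce
  then show "{(p @ [v]) ! i, (p @ [v]) ! Suc i} \<in> E"
  proof cases
    case 1
    then show ?thesis using assms(1) by (auto simp: is_path_def nth_append)
  next
    case 2
    then have "p ! i = u" using assms(1) by (metis diff_Suc_1 is_path_def last_conv_nth)
    then show ?thesis using 2 assms(2) by (simp add: nth_append)
  qed
qed (use assms in \<open>auto simp: is_path_def\<close>)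

text \<open>Appending a vertex must keep the path \<open>distinct\<close>. The bound on
  \<open>D\<close> carried through the induction does this: a new vertex of larger potential cannot
  occur earlier.\<close>

lemma graph_dist_potential_path:
  fixes D :: "'v \<Rightarrow> enat"
  assumes zero: "\<And>v. v \<in> X \<Longrightarrow> D v = 0 \<Longrightarrow> v = x"
    and pred: "\<And>v l. v \<in> X \<Longrightarrow> D v = enat (Suc l) \<Longrightarrow> \<exists>u\<in>X. {u, v} \<in> E \<and> D u = enat l"
    and "v \<in> X" "D v = enat l"
  shows "\<exists>p. is_path X E x p v \<and> length p = Suc l \<and> (\<forall>w\<in>set p. D w \<le> enat l)"
  using assms(3,4)
proof (induction l arbitrary: v)
  case 0
  then have "v = x" using zero by (simp add: zero_enat_def)
  then show ?case using 0 by (intro exI[of _ "[x]"]) (auto simp: is_path_def)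
next
  case (Suc l)
  from pred[OF Suc.prems] obtain u where u: "u \<in> X" "{u, v} \<in> E" "D u = enat l" by blast
  from Suc.IH[OF u(1,3)] obtain p where p: "is_path X E x p u" "length p = Suc l"
    "\<forall>w\<in>set p. D w \<le> enat l" by blast
  have "v \<notin> set p" using p(3) Suc.prems(2) by auto
  have "is_path X E x (p @ [v]) v" using p(1) u(2) Suc.prems(1) \<open>v \<notin> set p\<close> by (rule is_path_snoc)
  moreover have "\<forall>w\<in>set (p @ [v]). D w \<le> enat (Suc l)"
    using p(3) Suc.prems(2) by (auto intro: order_trans)
  ultimately show ?case using p(2) by (intro exI[of _ "p @ [v]"]) auto
qed

text \<open>A potential that vanishes exactly at the source, grows by at most 1 along edges and
  drops by 1 towards some neighbour is the distance: growth bounds all paths from below, descent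
  builds one. Distances in two graphs can thus be compared without transporting paths.\<close>

lemma graph_dist_eqI:
  fixes D :: "'v \<Rightarrow> enat"
  assumes "\<And>u v. {u, v} \<in> E \<Longrightarrow> u \<in> X \<Longrightarrow> v \<in> X \<Longrightarrow> D v \<le> D u + 1" and "D x = 0"
    and "\<And>v. v \<in> X \<Longrightarrow> D v = 0 \<Longrightarrow> v = x"
    and "\<And>v l. v \<in> X \<Longrightarrow> D v = enat (Suc l) \<Longrightarrow> \<exists>u\<in>X. {u, v} \<in> E \<and> D u = enat l"
    and "v \<in> X"
  shows "graph_dist X E x v = D v"
proof (rule antisym)
  show "D v \<le> graph_dist X E x v" by (rule graph_dist_least[where D = D, OF assms(1,2)])
  show "graph_dist X E x v \<le> D v"
  proof (cases "D v")
    case (enat l)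
    with graph_dist_potential_path[where D = D, OF assms(3,4,5)] show ?thesis
      by (metis diff_Suc_1 graph_dist_le)
  qed auto
qed

lemma graph_dist_self: "x \<in> X \<Longrightarrow> graph_dist X E x x = 0"
  using graph_dist_le[of X E x "[x]" x] by (simp add: is_path_def zero_enat_def[symmetric])

lemma graph_dist_eq_0D: "graph_dist X E x y = 0 \<Longrightarrow> x = y"
  unfolding zero_enat_def
  by (elim graph_dist_attained) (auto simp: is_path_def length_Suc_conv)

lemma graph_dist_less_card:
  assumes "finite X" "graph_dist X E x y = enat l"
  shows "l < card X"
proof -
  obtain p where p: "is_path X E x p y" "length p = Suc l"
    using graph_dist_attained[OF assms(2)] .
  have "Suc l = card (set p)" using p by (simp add: is_path_def distinct_card)
  also have "\<dots> \<le> card X" using p assms(1) by (auto simp: is_path_def intro: card_mono)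
  finally show ?thesis by simp
qed

lemma is_path_prefix:
  assumes "is_path X E x p y" "i < length p"
  shows "is_path X E x (take (Suc i) p) (p ! i)"
proof -
  have "set (take (Suc i) p) \<subseteq> X"
    using assms(1) set_take_subset[of "Suc i" p] unfolding is_path_def by blast
  moreover have "take (Suc i) p ! (min (length p) (Suc i) - Suc 0) = p ! i"
    using assms(2) by (simp add: min_absorb2 Suc_leI)
  ultimately show ?thesis
    using assms by (auto simp: is_path_def hd_conv_nth last_conv_nth)
qed

text \<open>A shortest path to \<open>u\<close> cannot be extended by \<open>v\<close> if
  \<open>v\<close> already lies on it; but then a prefix ends in \<open>v\<close> and is no longer
  than the path to \<open>u\<close>.\<close>

lemma graph_dist_edge_le:
  assumes "{u, v} \<in> E" "u \<in> X" "v \<in> X"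
  shows "graph_dist X E x v \<le> graph_dist X E x u + 1"
proof (cases "graph_dist X E x u")
  case (enat l)
  obtain p where p: "is_path X E x p u" "length p = Suc l" using graph_dist_attained[OF enat] .
  show ?thesis
  proof (cases "v \<in> set p")
    case True
    then obtain i where i: "i < length p" "p ! i = v" by (auto simp: in_set_conv_nth)
    have "graph_dist X E x v \<le> enat i"
      using graph_dist_le[OF is_path_prefix[OF p(1) i(1)]] i by (simp add: min_absorb2)
    also have "\<dots> \<le> enat l + 1" using i p by (simp add: one_enat_def)
    finally show ?thesis using enat by simp
  next
    case False
    have "is_path X E x (p @ [v]) v" using p(1) assms(1,3) False by (rule is_path_snoc)
    from graph_dist_le[OF this] p(2) enat show ?thesis by (simp add: one_enat_def)
  qed
qed simp

lemma graph_dist_pred: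
  assumes "graph_dist X E x v = enat (Suc l)"
  obtains u where "u \<in> X" "v \<in> X" "{u, v} \<in> E" "graph_dist X E x u = enat l"
proof -
  obtain p where p: "is_path X E x p v" "length p = Suc (Suc l)"
    using graph_dist_attained[OF assms] .
  have v: "p ! Suc l = v" using p by (metis diff_Suc_1 is_path_def last_conv_nth)
  have e: "{p ! l, v} \<in> E" using p v by (auto simp: is_path_def)
  have mem: "p ! l \<in> X" "v \<in> X" using p v by (auto simp: is_path_def)
  have "graph_dist X E x (p ! l) \<le> enat l"
    using graph_dist_le[OF is_path_prefix[OF p(1), of l]] p by simp
  moreover have "enat (Suc l) \<le> graph_dist X E x (p ! l) + 1"
    using graph_dist_edge_le[OF e mem, of x] assms by simp
  ultimately have "graph_dist X E x (p ! l) = enat l"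
    by (cases "graph_dist X E x (p ! l)") (auto simp: one_enat_def)
  then show ?thesis using that e mem by blast
qed

text \<open>The recursion that one level of the breadth-first search circuit evaluates.\<close>

lemma graph_dist_le_Suc_iff:
  assumes "v \<in> X"
  shows "graph_dist X E x v \<le> enat (Suc l) \<longleftrightarrow>
    graph_dist X E x v \<le> enat l \<or> (\<exists>u\<in>X. {u, v} \<in> E \<and> graph_dist X E x u \<le> enat l)"
proof (intro iffI; (elim disjE bexE conjE)?)
  assume "graph_dist X E x v \<le> enat (Suc l)"
  then consider "graph_dist X E x v = enat (Suc l)" | "graph_dist X E x v \<le> enat l"
    by (cases "graph_dist X E x v") force+
  then show "graph_dist X E x v \<le> enat l \<or> (\<exists>u\<in>X. {u, v} \<in> E \<and> graph_dist X E x u \<le> enat l)"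
    by cases (auto elim!: graph_dist_pred)
next
  fix u assume "u \<in> X" "{u, v} \<in> E" "graph_dist X E x u \<le> enat l"
  then show "graph_dist X E x v \<le> enat (Suc l)"
    using graph_dist_edge_le[of u v E X x] assms add_right_mono[of _ "enat l" 1]
    by (metis eSuc_enat order_trans plus_1_eSuc(2))
qed (auto intro: order_trans)

lemma graph_dist_le_0_iff:
  "x \<in> X \<Longrightarrow> graph_dist X E x v \<le> enat 0 \<longleftrightarrow> v = x"
  using graph_dist_self[of x X E] graph_dist_eq_0D[of X E x v] by (auto simp: zero_enat_def[symmetric])

section \<open>Counting solutions\<close>

text \<open>An edge between vertices equidistant from the source has no influence on distances from
  it. Hence \<open>down\<close> tolerates additional edges inside a level, and \<open>up\<close>
  demands only the edges between different levels.\<close>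

lemma graph_dist_pullback:
  assumes h: "bij_betw h Y X" and x: "x \<in> Y"
    and down: "\<And>u v. u \<in> Y \<Longrightarrow> v \<in> Y \<Longrightarrow> {u, v} \<in> E' \<Longrightarrow>
      {h u, h v} \<in> E \<or> graph_dist X E (h x) (h u) = graph_dist X E (h x) (h v)"
    and up: "\<And>u v. u \<in> Y \<Longrightarrow> v \<in> Y \<Longrightarrow> {h u, h v} \<in> E \<Longrightarrow>
      graph_dist X E (h x) (h u) \<noteq> graph_dist X E (h x) (h v) \<Longrightarrow> {u, v} \<in> E'"
    and v: "v \<in> Y"
  shows "graph_dist Y E' x v = graph_dist X E (h x) (h v)"
proof (rule graph_dist_eqI[where D = "\<lambda>v. graph_dist X E (h x) (h v)"])
  have mem: "h u \<in> X" if "u \<in> Y" for u using h that by (auto simp: bij_betw_def)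
  show "graph_dist X E (h x) (h v) \<le> graph_dist X E (h x) (h u) + 1"
    if "{u, v} \<in> E'" "u \<in> Y" "v \<in> Y" for u v
    using down[OF that(2,3,1)] graph_dist_edge_le[of "h u" "h v" E X "h x"] mem that
    by (auto intro: add_increasing2)
  show "graph_dist X E (h x) (h x) = 0" using mem x by (simp add: graph_dist_self)
  show "v = x" if "v \<in> Y" "graph_dist X E (h x) (h v) = 0" for v
    using graph_dist_eq_0D[OF that(2)] h that(1) x by (auto simp: bij_betw_def inj_on_def)
  show "\<exists>u\<in>Y. {u, v} \<in> E' \<and> graph_dist X E (h x) (h u) = enat l"
    if "v \<in> Y" and d: "graph_dist X E (h x) (h v) = enat (Suc l)" for v l
  proof -
    obtain w where w: "w \<in> X" "{w, h v} \<in> E" "graph_dist X E (h x) w = enat l"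
      using graph_dist_pred[OF d] by blast
    then obtain u where u: "u \<in> Y" "w = h u" using h by (auto simp: bij_betw_def)
    have "{u, v} \<in> E'" using w u that by (intro up) auto
    then show ?thesis using w u by blast
  qed
qed (rule v)

lemma is_solution_bound:
  fixes m n :: nat
  assumes "is_solution {1..m} d0 {1..n} E"
  shows "m \<le> n"
proof -
  have "card {1..m} \<le> card {1..n}"
    using assms by (intro card_mono) (auto simp: is_solution_def)
  then show ?thesis by simp
qed

text \<open>A solution may live on any \<open>n\<close> naturals that include the terminals, whereas
  adjacency vectors describe graphs on \<open>{1..n}\<close>. The renaming fixes each terminal, so
  the prescribed distances carry over.\<close>

lemma admits_solution_relabel:
  assumes "admits_solution n m d0"
  obtains E where "is_solution {1..m} d0 {1..n} E"
proof -
  from assms obtain X E where X: "finite X" "card X = n" and sol: "is_solution {1..m} d0 X E"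
    by (auto simp: admits_solution_def)
  have sub: "{1..m} \<subseteq> X" using sol by (simp add: is_solution_def)
  have mn: "m \<le> n" using card_mono[OF X(1) sub] X(2) by simp
  have "card {m<..n} = card (X - {1..m})" using X sub by (simp add: card_Diff_subset)
  then obtain g where g: "bij_betw g {m<..n} (X - {1..m})"
    using finite_same_card_bij[of "{m<..n}" "X - {1..m}"] X by auto
  define h where "h = (\<lambda>v. if v \<le> m then v else g v)"
  have "bij_betw h ({1..m} \<union> {m<..n}) ({1..m} \<union> (X - {1..m}))"
  proof (rule bij_betw_combine)
    show "bij_betw h {1..m} {1..m}"
      by (rule bij_betw_cong[THEN iffD1, OF _ bij_betw_id]) (auto simp: h_def)
    show "bij_betw h {m<..n} (X - {1..m})"
      by (rule bij_betw_cong[THEN iffD1, OF _ g]) (auto simp: h_def)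
  qed auto
  moreover have "{1..m} \<union> {m<..n} = {1..n}" "{1..m} \<union> (X - {1..m}) = X" using mn sub by auto
  ultimately have h: "bij_betw h {1..n} X" by simp
  define E' where "E' = {{u, v} |u v. u \<in> {1..n} \<and> v \<in> {1..n} \<and> {h u, h v} \<in> E}"
  have E': "{u, v} \<in> E' \<longleftrightarrow> {h u, h v} \<in> E" if "u \<in> {1..n}" "v \<in> {1..n}" for u v
    unfolding E'_def using that by (fastforce simp: doubleton_eq_iff insert_commute)
  have neq: "h u \<noteq> h v" if "{h u, h v} \<in> E" for u v
    using that sol by (force simp: is_solution_def simple_graph_def doubleton_eq_iff)
  have "simple_graph {1..n} E'"
    unfolding simple_graph_def E'_def using neq by blast
  moreover have "graph_dist {1..n} E' x y = enat (d0 x y)" if "x \<in> {1..m}" "y \<in> {1..m}" for x y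
  proof -
    have "graph_dist {1..n} E' x y = graph_dist X E (h x) (h y)"
      using that mn by (intro graph_dist_pullback[OF h]) (auto simp: E')
    moreover have "h x = x" "h y = y" using that by (auto simp: h_def)
    ultimately show ?thesis using sol that by (simp add: is_solution_def)
  qed
  ultimately show ?thesis using mn that[of E'] by (auto simp: is_solution_def)
qed

section \<open>Adjacency vectors as edge sets\<close>

lemma set_vertex_pairs: "set (vertex_pairs n) = {(j, k). 1 \<le> j \<and> j < k \<and> k \<le> n}"
  by (force simp: vertex_pairs_def image_iff simp del: upt_Suc)

lemma distinct_vertex_pairs: "distinct (vertex_pairs n)"
proof -
  have "distinct (concat (map (\<lambda>j. map (Pair j) (f j)) xs))"
    if "distinct xs" "\<And>j. distinct (f j)" for f :: "nat \<Rightarrow> nat list" and xs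
    using that by (induction xs) (auto simp: distinct_map inj_on_def)
  from this[of "[1..<Suc n]" "\<lambda>j. [Suc j..<Suc n]"] show ?thesis
    unfolding vertex_pairs_def by simp
qed

lemma length_vertex_pairs: "length (vertex_pairs n) = num_pairs n"
proof -
  have "length (vertex_pairs n) = (\<Sum>j\<leftarrow>[1..<Suc n]. n - j)"
    unfolding vertex_pairs_def length_concat map_map comp_def by (simp del: upt_Suc)
  also have "\<dots> = (\<Sum>j\<in>{1..<Suc n}. n - j)"
    by (subst sum_list_distinct_conv_sum_set) (auto simp del: upt_Suc)
  also have "\<dots> = (\<Sum>i\<in>{0..<n}. i)"
    by (rule sum.reindex_bij_witness[of _ "\<lambda>i. n - i" "\<lambda>j. n - j"]) auto
  also have "\<dots> = num_pairs n"
    by (cases n) (simp_all add: num_pairs_def atLeastLessThanSuc_atLeastAtMost Sum_Icc_nat mult.commute)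
  finally show ?thesis .
qed

text \<open>The index comes before the quantifier over \<open>e\<close>: a circuit can be wired to
  it once for all adjacency vectors.\<close>

lemma ex_pair_index:
  assumes "u \<in> {1..n}" "v \<in> {1..n}" "u \<noteq> v"
  shows "\<exists>i<num_pairs n. \<forall>e. {u, v} \<in> edges_of n e \<longleftrightarrow> e ! i"
proof -
  let ?p = "(min u v, max u v)"
  have "?p \<in> set (vertex_pairs n)" using assms by (auto simp: set_vertex_pairs)
  then obtain i where i: "i < length (vertex_pairs n)" "vertex_pairs n ! i = ?p"
    by (auto simp: in_set_conv_nth)
  have uniq: "i' = i" if "i' < length (vertex_pairs n)"
    "{u, v} = {fst (vertex_pairs n ! i'), snd (vertex_pairs n ! i')}" for i'
  proof -
    obtain a b where ab: "vertex_pairs n ! i' = (a, b)" by fastforce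
    have "(a, b) \<in> set (vertex_pairs n)" using that(1) ab nth_mem by metis
    then have "a < b" by (simp add: set_vertex_pairs)
    moreover have "u = a \<and> v = b \<or> u = b \<and> v = a" using that(2) ab by (simp add: doubleton_eq_iff)
    ultimately have "vertex_pairs n ! i' = ?p" using ab by (elim disjE) simp_all
    then show ?thesis using i that(1) distinct_vertex_pairs nth_eq_iff_index_eq by metis
  qed
  have p: "{u, v} = {fst (vertex_pairs n ! i), snd (vertex_pairs n ! i)}"
    unfolding i(2) by (auto simp: min_def max_def)
  have "{u, v} \<in> edges_of n e \<longleftrightarrow> e ! i" for e
  proof
    assume "{u, v} \<in> edges_of n e"
    then obtain i' where "i' < length (vertex_pairs n)" "e ! i'"
      "{u, v} = {fst (vertex_pairs n ! i'), snd (vertex_pairs n ! i')}"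
      unfolding edges_of_def by blast
    then show "e ! i" using uniq by blast
  next
    assume "e ! i"
    then show "{u, v} \<in> edges_of n e" unfolding edges_of_def using i(1) p by blast
  qed
  then show ?thesis using i by (auto simp: length_vertex_pairs)
qed

lemma edges_of_subset: "edges_of n e \<subseteq> {{x, y} |x y. x \<in> {1..n} \<and> y \<in> {1..n} \<and> x \<noteq> y}"
proof
  fix a assume "a \<in> edges_of n e"
  then obtain i where i: "i < length (vertex_pairs n)"
    "a = {fst (vertex_pairs n ! i), snd (vertex_pairs n ! i)}" by (auto simp: edges_of_def)
  have "vertex_pairs n ! i \<in> set (vertex_pairs n)" using i(1) by simp
  then show "a \<in> {{x, y} |x y. x \<in> {1..n} \<and> y \<in> {1..n} \<and> x \<noteq> y}"
    unfolding i(2) set_vertex_pairs by fastforce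
qed

lemma edges_of_surj:
  assumes "simple_graph {1..n} E"
  obtains e where "e \<in> bitstrings (num_pairs n)" "edges_of n e = E"
proof
  let ?e = "map (\<lambda>(j, k). {j, k} \<in> E) (vertex_pairs n)"
  show "?e \<in> bitstrings (num_pairs n)" by (simp add: bitstrings_def length_vertex_pairs)
  have "a \<in> edges_of n ?e" if a: "a \<in> E" for a
  proof -
    obtain x y where xy: "a = {x, y}" "x \<in> {1..n}" "y \<in> {1..n}" "x \<noteq> y"
      using a assms unfolding simple_graph_def by blast
    then have "(min x y, max x y) \<in> set (vertex_pairs n)" by (auto simp: set_vertex_pairs)
    then obtain i where i: "i < length (vertex_pairs n)" "vertex_pairs n ! i = (min x y, max x y)"
      by (auto simp: in_set_conv_nth)
    have "{x, y} = {min x y, max x y}" by (auto simp: min_def max_def)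
    then show ?thesis using i a xy(1) unfolding edges_of_def
      by (intro CollectI exI[of _ i]) auto
  qed
  moreover have "edges_of n ?e \<subseteq> E" by (auto simp: edges_of_def case_prod_beta)
  ultimately show "edges_of n ?e = E" by blast
qed

lemma finite_bitstrings: "finite (bitstrings N)" and card_bitstrings: "card (bitstrings N) = 2 ^ N"
  using finite_lists_length_eq[of "UNIV :: bool set" N] card_lists_length_eq[of "UNIV :: bool set" N]
  by (simp_all add: bitstrings_def)

text \<open>The check compares distances only. That the terminals are vertices follows because the
  finite distance from \<open>x\<close> to itself is attained by a path, whose first vertex lies in
  \<open>{1..n}\<close>.\<close>

lemma classical_check_iff:
  assumes "e \<in> bitstrings (num_pairs n)"
  shows "classical_check n m d0 e \<longleftrightarrow> e \<in> solutions n m d0"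
proof
  assume c: "classical_check n m d0 e"
  have "x \<in> {1..n}" if "x \<in> {1..m}" for x
  proof -
    have "graph_dist {1..n} (edges_of n e) x x = enat (d0 x x)"
      using c that by (auto simp: classical_check_def)
    then obtain p where "is_path {1..n} (edges_of n e) x p x" by (rule graph_dist_attained)
    then show ?thesis unfolding is_path_def by (metis list.set_sel(1) subsetD)
  qed
  then show "e \<in> solutions n m d0"
    using c assms edges_of_subset[of n e]
    unfolding solutions_def is_solution_def classical_check_def simple_graph_def by blast
qed (simp add: solutions_def is_solution_def classical_check_def)

text \<open>Edges between vertices with the same distances to all terminals are irrelevant to those
  distances. In the \<open>q\<close>-relabelled graph they are used to record the inversions of \<open>q\<close>
  within the classes of such vertices, so that \<open>q\<close> can be recovered from the graph even if the
  original graph has automorphisms.\<close>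

definition same_profile :: "nat \<Rightarrow> nat \<Rightarrow> nat set set \<Rightarrow> nat \<Rightarrow> nat \<Rightarrow> bool" where
  "same_profile n m E u v \<longleftrightarrow> (\<forall>b\<in>{1..m}. graph_dist {1..n} E b u = graph_dist {1..n} E b v)"

definition twisted_graph :: "nat \<Rightarrow> nat \<Rightarrow> nat set set \<Rightarrow> (nat \<Rightarrow> nat) \<Rightarrow> nat set set" where
  "twisted_graph n m E q = {{u, v} |u v. u \<in> {1..n} \<and> v \<in> {1..n} \<and> u < v \<and>
     (if same_profile n m E (q u) (q v) then q v < q u else {q u, q v} \<in> E)}"

lemma twisted_graph_iff:
  assumes "u \<in> {1..n}" "v \<in> {1..n}" "u < v"
  shows "{u, v} \<in> twisted_graph n m E q \<longleftrightarrow>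
    (if same_profile n m E (q u) (q v) then q v < q u else {q u, q v} \<in> E)"
proof -
  have "{u, v} = {u', v'} \<longleftrightarrow> u' = u \<and> v' = v" if "u' < v'" for u' v'
    using that assms(3) by (auto simp: doubleton_eq_iff)
  then show ?thesis unfolding twisted_graph_def mem_Collect_eq using assms by metis
qed

text \<open>The edges that \<open>twisted_graph\<close> sets freely join vertices whose images have
  the same profile and so are equidistant from every terminal. These are edges that
  \<open>graph_dist_pullback\<close> leaves open.\<close>

lemma graph_dist_twisted:
  assumes "m \<le> n" and q: "q permutes {m<..n}" and b: "b \<in> {1..m}" and v: "v \<in> {1..n}"
  shows "graph_dist {1..n} (twisted_graph n m E q) b v = graph_dist {1..n} E b (q v)"
proof -
  have qb: "q b = b" using permutes_not_in[OF q] b by auto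
  have qX: "q permutes {1..n}" by (rule permutes_subset[OF q]) auto
  have sym: "same_profile n m E u v \<longleftrightarrow> same_profile n m E v u" for u v
    by (auto simp: same_profile_def)
  have iff: "{u, v} \<in> twisted_graph n m E q \<longleftrightarrow> {q u, q v} \<in> E"
    if "u \<in> {1..n}" "v \<in> {1..n}" "\<not> same_profile n m E (q u) (q v)" for u v
  proof (cases u v rule: linorder_cases)
    case equal
    then show ?thesis using that by (simp add: same_profile_def)
  qed (use that sym twisted_graph_iff[of u n v m E q] twisted_graph_iff[of v n u m E q]
        in \<open>auto simp: insert_commute\<close>)
  have "graph_dist {1..n} (twisted_graph n m E q) b v = graph_dist {1..n} E (q b) (q v)"
  proof (rule graph_dist_pullback)
    show "bij_betw q {1..n} {1..n}" by (rule permutes_imp_bij[OF qX])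
    show "{q u, q v} \<in> E \<or> graph_dist {1..n} E (q b) (q u) = graph_dist {1..n} E (q b) (q v)"
      if "u \<in> {1..n}" "v \<in> {1..n}" "{u, v} \<in> twisted_graph n m E q" for u v
      using iff[OF that(1,2)] that(3) b unfolding qb same_profile_def by blast
    show "{u, v} \<in> twisted_graph n m E q"
      if "u \<in> {1..n}" "v \<in> {1..n}" "{q u, q v} \<in> E"
        "graph_dist {1..n} E (q b) (q u) \<noteq> graph_dist {1..n} E (q b) (q v)" for u v
      using iff[OF that(1,2)] that(3,4) b unfolding qb same_profile_def by blast
  qed (use b v assms(1) in auto)
  then show ?thesis by (simp add: qb)
qed

text \<open>Equal twisted graphs give \<open>q z\<close> and \<open>q' z\<close> the same profile
  for every vertex \<open>z\<close>, because profiles are read off the distances in the graph. Then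
  \<open>q u \<le> q' u\<close> follows by strong induction on \<open>q u\<close>, and exchanging
  the permutations gives equality.\<close>

lemma twisted_graph_inj:
  assumes mn: "m \<le> n"
  shows "inj_on (twisted_graph n m E) {q. q permutes {m<..n}}"
proof -
  have le: "q u \<le> q' u"
    if q: "q permutes {m<..n}" and q': "q' permutes {m<..n}"
      and eq: "twisted_graph n m E q = twisted_graph n m E q'" and u: "u \<in> {1..n}" for q q' u
    using u
  proof (induction "q u" arbitrary: u rule: less_induct)
    case less
    have qX: "q permutes {1..n}" by (rule permutes_subset[OF q]) auto
    have qX': "q' permutes {1..n}" by (rule permutes_subset[OF q']) auto
    have prof: "graph_dist {1..n} E b (q w) = graph_dist {1..n} E b (q' w)"
      if "b \<in> {1..m}" "w \<in> {1..n}" for b w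
      using graph_dist_twisted[OF mn q that, of E] graph_dist_twisted[OF mn q' that, of E] eq by simp
    show ?case
    proof (rule ccontr)
      assume "\<not> q u \<le> q' u"
      \<comment> \<open>If \<open>q' u < q u\<close>, let \<open>w\<close> be the vertex that
        \<open>q\<close> sends to \<open>q' u\<close>. All images of \<open>u\<close> and
        \<open>w\<close> share one profile, so the edge \<open>{u, w}\<close> records in each graph
        how the permutation orders the two. Equal graphs yield \<open>q' w < q' u = q w\<close>,
        against the induction hypothesis at \<open>w\<close>.\<close>
      define w where "w = inv q (q' u)"
      have qw: "q w = q' u" unfolding w_def by (simp add: permutes_inverses(1)[OF q])
      have w: "w \<in> {1..n}"
        using qw permutes_in_image[OF qX, of w] permutes_in_image[OF qX', of u] less.prems by simp
      have lt: "q w < q u" using \<open>\<not> q u \<le> q' u\<close> qw by simp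
      have same: "same_profile n m E (q u) (q w)" "same_profile n m E (q' u) (q' w)"
        "same_profile n m E (q w) (q u)" "same_profile n m E (q' w) (q' u)"
        using prof[OF _ less.prems] prof[OF _ w] qw by (auto simp: same_profile_def)
      have "q' u \<noteq> q' w" using lt permutes_inj[OF q'] by (auto dest: injD)
      moreover have "u \<noteq> w" using lt by auto
      ultimately have "q' w < q' u"
        using twisted_graph_iff[OF less.prems w, of m E q] twisted_graph_iff[OF less.prems w, of m E q']
          twisted_graph_iff[OF w less.prems, of m E q] twisted_graph_iff[OF w less.prems, of m E q']
          same lt eq by (cases u w rule: linorder_cases) auto
      then show False using less.hyps[OF lt w] qw by simp
    qed
  qed
  show ?thesis
  proof (intro inj_onI ext)
    fix q q' u
    assume *: "q \<in> {q. q permutes {m<..n}}" "q' \<in> {q. q permutes {m<..n}}"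
      "twisted_graph n m E q = twisted_graph n m E q'"
    show "q u = q' u"
    proof (cases "u \<in> {1..n}")
      case True
      then show ?thesis using le[of q q' u] le[of q' q u] * by auto
    next
      case False
      then have "u \<notin> {m<..n}" by auto
      then show ?thesis using * by (simp add: permutes_not_in)
    qed
  qed
qed

lemma twisted_graph_is_solution:
  assumes "is_solution {1..m} d0 {1..n} E" "q permutes {m<..n}"
  shows "is_solution {1..m} d0 {1..n} (twisted_graph n m E q)"
proof -
  note mn = is_solution_bound[OF assms(1)]
  have "q y = y" if "y \<in> {1..m}" for y using permutes_not_in[OF assms(2)] that by auto
  moreover have "simple_graph {1..n} (twisted_graph n m E q)"
    unfolding simple_graph_def twisted_graph_def by blast
  ultimately show ?thesis
    using assms graph_dist_twisted[OF mn assms(2)] mn by (auto simp: is_solution_def)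
qed

lemma card_solutions_ge_fact:
  assumes "admits_solution n m d0"
  shows "fact (n - m) \<le> card (solutions n m d0)" and "m \<le> n"
proof -
  obtain E where E: "is_solution {1..m} d0 {1..n} E" using admits_solution_relabel[OF assms] .
  show mn: "m \<le> n" using is_solution_bound[OF E] .
  have fin: "finite (solutions n m d0)"
    by (rule finite_subset[OF _ finite_bitstrings[of "num_pairs n"]]) (auto simp: solutions_def)
  \<comment> \<open>Edge sets are counted instead of adjacency vectors: the image of the solutions
    under \<open>edges_of\<close> is no larger than the set of solutions itself.\<close>
  have "twisted_graph n m E ` {q. q permutes {m<..n}} \<subseteq> edges_of n ` solutions n m d0"
  proof safe
    fix q assume "q permutes {m<..n}"
    then have sol: "is_solution {1..m} d0 {1..n} (twisted_graph n m E q)"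
      using twisted_graph_is_solution[OF E] by blast
    then obtain e where "e \<in> bitstrings (num_pairs n)" "edges_of n e = twisted_graph n m E q"
      using edges_of_surj unfolding is_solution_def by blast
    then show "twisted_graph n m E q \<in> edges_of n ` solutions n m d0"
      using sol by (intro image_eqI[of _ _ e]) (auto simp: solutions_def)
  qed
  then have "card (twisted_graph n m E ` {q. q permutes {m<..n}}) \<le> card (solutions n m d0)"
    using fin by (meson card_image_le card_mono finite_imageI order_trans)
  moreover have "card (twisted_graph n m E ` {q. q permutes {m<..n}}) = fact (n - m)"
    using twisted_graph_inj[OF mn, of E] card_permutations[of "{m<..n}" "n - m"]
    by (simp add: card_image)
  ultimately show "fact (n - m) \<le> card (solutions n m d0)" by simp
qed

section \<open>Grover iterations\<close>

lemma app_op_ket: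
  assumes "c \<in> bitstrings q"
  shows "app_op q A (ket c) b = (if b \<in> bitstrings q then A b c else 0)"
  using assms finite_bitstrings[of q] by (simp add: app_op_def ket_def if_distrib cong: if_cong)

text \<open>\<open>\<Sum>\<^sub>x \<phi> x |x\<rangle> \<otimes> (|0\<rangle> - |1\<rangle>)/\<surd>2 \<otimes> |0\<rangle>\<^sub>k\<close>\<close>
definition kickback_state :: "nat \<Rightarrow> nat \<Rightarrow> (bool list \<Rightarrow> complex) \<Rightarrow> qstate" where
  "kickback_state N k \<phi> b =
     (if b \<in> bitstrings (N + 1 + k) \<and> drop (Suc N) b = replicate k False
      then \<phi> (take N b) * (if b ! N then - 1 else 1) / complex_of_real (sqrt 2) else 0)"

text \<open>Phase kickback: flipping the target exchanges the two terms of \<open>|0> - |1>\<close>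
  and so changes the sign. The columns of \<open>U\<close> that are not prescribed meet zero
  amplitudes.\<close>

lemma app_op_oracle_kickback:
  assumes "quantum_oracle N T k U"
  shows "app_op (N + 1 + k) U (kickback_state N k \<phi>) =
    kickback_state N k (\<lambda>x. if x \<in> T then - \<phi> x else \<phi> x)"
proof
  fix b
  define q where "q = N + 1 + k"
  define S where "S = {c \<in> bitstrings q. drop (Suc N) c = replicate k False}"
  define F where "F c = c[N := (c ! N \<noteq> (take N c \<in> T))]" for c :: "bool list"
  have len: "length c = N + 1 + k" if "c \<in> S" for c using that by (simp add: S_def q_def bitstrings_def)
  have FS: "F c \<in> S" if "c \<in> S" for c using that by (simp add: S_def F_def bitstrings_def)
  have FF: "F (F c) = c" if "c \<in> S" for c 
    using len[OF that] by (cases "take N c \<in> T") (simp_all add: F_def)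
  have U: "U b c = ket (F c) b" if c: "c \<in> S" and b: "b \<in> bitstrings q" for c
  proof -
    have c_eq: "c = take N c @ [c ! N] @ replicate k False"
      using id_take_nth_drop[of N c] len[OF c] c by (simp add: S_def)
    have "take N c \<in> bitstrings N" using len[OF c] by (simp add: bitstrings_def)
    then have "app_op q U (ket (take N c @ [c ! N] @ replicate k False)) =
        ket (take N c @ [c ! N \<noteq> (take N c \<in> T)] @ replicate k False)"
      using assms by (simp add: quantum_oracle_def q_def)
    moreover have "F c = take N c @ [c ! N \<noteq> (take N c \<in> T)] @ replicate k False"
      using c len[OF c] by (simp add: F_def S_def upd_conv_take_nth_drop)
    ultimately have "app_op q U (ket c) = ket (F c)" using c_eq by metis
    then show ?thesis using app_op_ket[of c q U b] b c by (simp add: S_def)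
  qed
  show "app_op (N + 1 + k) U (kickback_state N k \<phi>) b =
    kickback_state N k (\<lambda>x. if x \<in> T then - \<phi> x else \<phi> x) b"
  proof (cases "b \<in> bitstrings q")
    case b: True
    have "app_op (N + 1 + k) U (kickback_state N k \<phi>) b =
        (\<Sum>c\<in>bitstrings q. U b c * kickback_state N k \<phi> c)"
      using b by (simp add: app_op_def q_def)
    also have "\<dots> = (\<Sum>c\<in>S. U b c * kickback_state N k \<phi> c)"
      by (rule sum.mono_neutral_right) (auto simp: finite_bitstrings S_def kickback_state_def q_def)
    \<comment> \<open>\<open>F\<close> is an involution on \<open>S\<close>, so a row
      \<open>b\<close> in \<open>S\<close> has its only nonzero entry among the columns of
      \<open>S\<close> at \<open>F b\<close>, and a row outside \<open>S\<close> has none.\<close>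
    also have "\<dots> = (\<Sum>c\<in>S. if c = F b \<and> b \<in> S then kickback_state N k \<phi> c else 0)"
      using U[OF _ b] FF FS by (intro sum.cong) (auto simp: ket_def)
    also have "\<dots> = (if b \<in> S then kickback_state N k \<phi> (F b) else 0)"
    proof (cases "b \<in> S")
      case True
      have "finite S" using finite_bitstrings[of q] by (simp add: S_def)
      then show ?thesis using True FS[OF True] by simp
    qed simp
    also have "\<dots> = kickback_state N k (\<lambda>x. if x \<in> T then - \<phi> x else \<phi> x) b"
      using FS[of b] len[of b] b
      by (auto simp: kickback_state_def S_def q_def F_def)
    finally show ?thesis .
  qed (simp add: app_op_def kickback_state_def q_def)
qed

lemma powr_minus_half_sq: "(2 powr (- (real N / 2)) :: real)\<^sup>2 = 1 / 2 ^ N"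
proof -
  have "(2 powr (- (real N / 2)) :: real)\<^sup>2 = 2 powr (- real N)"
    by (simp add: power2_eq_square flip: powr_add)
  then show ?thesis by (simp add: powr_minus powr_realpow divide_simps)
qed

lemma diffusion_eq:
  assumes "b \<in> bitstrings N" "c \<in> bitstrings N"
  shows "diffusion N b c = 2 / 2 ^ N - (if b = c then 1 else 0)"
proof -
  have u: "uniform_state N a = complex_of_real (2 powr (- (real N / 2)))" if "a \<in> bitstrings N" for a
    using that finite_bitstrings[of N] by (simp add: uniform_state_def ket_def)
  have "uniform_state N b * cnj (uniform_state N c) = complex_of_real ((2 powr (- (real N / 2)))\<^sup>2)"
    using assms by (simp add: u power2_eq_square)
  also have "\<dots> = 1 / 2 ^ N" by (subst powr_minus_half_sq) simp
  finally show ?thesis by (simp add: diffusion_def id_op_def)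
qed

text \<open>Inversion about the mean on the adjacency register. Target and ancillas enter only
  through the factor \<open>s\<close>, which is common to all terms of the sum.\<close>

lemma app_op_diffusion_kickback:
  "app_op (N + 1 + k) (on_first N (diffusion N)) (kickback_state N k \<phi>) =
    kickback_state N k (\<lambda>x. 2 / 2 ^ N * (\<Sum>y\<in>bitstrings N. \<phi> y) - \<phi> x)"
proof
  fix b
  define q where "q = N + 1 + k"
  show "app_op (N + 1 + k) (on_first N (diffusion N)) (kickback_state N k \<phi>) b =
    kickback_state N k (\<lambda>x. 2 / 2 ^ N * (\<Sum>y\<in>bitstrings N. \<phi> y) - \<phi> x) b"
  proof (cases "b \<in> bitstrings q")
    case b: True
    then have len: "length b = N + 1 + k" by (simp add: q_def bitstrings_def)
    define s where "s = (if drop (Suc N) b = replicate k False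
      then (if b ! N then - 1 else 1) / complex_of_real (sqrt 2) else 0)"
    let ?C = "{c \<in> bitstrings q. drop N b = drop N c}"
    have tb: "take N b \<in> bitstrings N" using len by (simp add: bitstrings_def)
    have "app_op (N + 1 + k) (on_first N (diffusion N)) (kickback_state N k \<phi>) b =
        (\<Sum>c\<in>bitstrings q. diffusion N (take N b) (take N c) * id_op (drop N b) (drop N c) *
           kickback_state N k \<phi> c)"
      using b by (simp add: app_op_def q_def on_first_def)
    also have "\<dots> = (\<Sum>c\<in>?C. diffusion N (take N b) (take N c) * kickback_state N k \<phi> c)"
      by (rule sum.mono_neutral_cong_right) (auto simp: finite_bitstrings id_op_def)
    also have "\<dots> = (\<Sum>y\<in>bitstrings N. diffusion N (take N b) y * kickback_state N k \<phi> (y @ drop N b))"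
      by (rule sum.reindex_bij_witness[of _ "\<lambda>y. y @ drop N b" "take N"])
        (use len in \<open>auto simp: bitstrings_def q_def\<close>)
    also have "\<dots> = (\<Sum>y\<in>bitstrings N. (2 / 2 ^ N - (if take N b = y then 1 else 0)) * (\<phi> y * s))"
    proof (rule sum.cong[OF refl])
      fix y assume y: "y \<in> bitstrings N"
      then have "kickback_state N k \<phi> (y @ drop N b) = \<phi> y * s"
        using len by (auto simp: kickback_state_def s_def bitstrings_def nth_append)
      then show "diffusion N (take N b) y * kickback_state N k \<phi> (y @ drop N b) =
          (2 / 2 ^ N - (if take N b = y then 1 else 0)) * (\<phi> y * s)"
        using diffusion_eq[OF tb y] by simp
    qed
    also have "\<dots> = (2 / 2 ^ N * (\<Sum>y\<in>bitstrings N. \<phi> y) - \<phi> (take N b)) * s"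
      using tb finite_bitstrings[of N]
      by (simp add: left_diff_distrib sum_subtractf sum_distrib_left sum_distrib_right mult.assoc
          if_distrib[where f = "\<lambda>z. z * _"] cong: if_cong)
    also have "\<dots> = kickback_state N k (\<lambda>x. 2 / 2 ^ N * (\<Sum>y\<in>bitstrings N. \<phi> y) - \<phi> x) b"
      using b by (simp add: kickback_state_def s_def q_def)
    finally show ?thesis .
  qed (simp add: app_op_def kickback_state_def q_def)
qed

lemma app_op_hadamard:
  assumes "i < q" "b \<in> bitstrings q"
  shows "app_op q (hadamard i) \<psi> b =
    (\<psi> (b[i := False]) + (if b ! i then - 1 else 1) * \<psi> (b[i := True])) / complex_of_real (sqrt 2)"
proof -
  have len: "length b = q" using assms(2) by (simp add: bitstrings_def)
  have "app_op q (hadamard i) \<psi> b = (\<Sum>c\<in>bitstrings q. hadamard i b c * \<psi> c)"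
    using assms by (simp add: app_op_def)
  also have "\<dots> = (\<Sum>c\<in>{b[i := False], b[i := True]}. hadamard i b c * \<psi> c)"
  proof (rule sum.mono_neutral_right)
    show "\<forall>c\<in>bitstrings q - {b[i := False], b[i := True]}. hadamard i b c * \<psi> c = 0"
    proof
      fix c assume "c \<in> bitstrings q - {b[i := False], b[i := True]}"
      then have "b[i := c ! i] \<noteq> c" by (cases "c ! i") auto
      then show "hadamard i b c * \<psi> c = 0" by (simp add: hadamard_def)
    qed
    show "finite (bitstrings q)" by (rule finite_bitstrings)
  qed (use len in \<open>auto simp: bitstrings_def\<close>)
  also have "b[i := False] \<noteq> b[i := True]"
    using assms len by (metis nth_list_update_eq)
  then have "(\<Sum>c\<in>{b[i := False], b[i := True]}. hadamard i b c * \<psi> c) =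
      (\<psi> (b[i := False]) + (if b ! i then - 1 else 1) * \<psi> (b[i := True])) / complex_of_real (sqrt 2)"
    using assms len by (simp add: hadamard_def add_divide_distrib)
  finally show ?thesis .
qed

lemma grover_init_eq:
  "grover_init N k = kickback_state N k (\<lambda>x. complex_of_real (2 powr (- (real N / 2))))"
proof -
  define q where "q = N + 1 + k"
  define c where "c = replicate N False @ [True] @ replicate k False"
  define \<sigma> where "\<sigma> = 1 / complex_of_real (sqrt 2)"
  have len_c: "length c = q" by (simp add: c_def q_def)
  have init: "app_op q (gate_op (NOT N)) (ket (replicate q False)) = ket c"
  proof
    fix b
    have "replicate q False = replicate N False @ [False] @ replicate k False"
      by (simp add: q_def replicate_add replicate_app_Cons_same)
    then have "gate_map (NOT N) (replicate q False) = c"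
      by (simp add: c_def list_update_append nth_append)
    then show "app_op q (gate_op (NOT N)) (ket (replicate q False)) b = ket c b"
      using len_c by (subst app_op_ket) (auto simp: bitstrings_def gate_op_def ket_def)
  qed
  \<comment> \<open>Qubits below \<open>N\<close> are \<open>0\<close> in \<open>c\<close>, so their
    Hadamards bring no sign. The target is \<open>1\<close> there, so the last Hadamard, treated
    separately, produces the minus sign of \<open>kickback_state\<close>.\<close>
  have part: "fold (\<lambda>i. app_op q (hadamard i)) [0..<j] (ket c) =
      (\<lambda>b. if b \<in> bitstrings q \<and> drop j b = drop j c then \<sigma> ^ j else 0)" if "j \<le> N" for j
    using that
  proof (induction j)
    case 0
    then show ?case using len_c by (auto simp: ket_def bitstrings_def)
  next
    case (Suc j)
    have "app_op q (hadamard j) (\<lambda>b. if b \<in> bitstrings q \<and> drop j b = drop j c then \<sigma> ^ j else 0) b =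
        (if b \<in> bitstrings q \<and> drop (Suc j) b = drop (Suc j) c then \<sigma> ^ Suc j else 0)" for b
    proof (cases "b \<in> bitstrings q")
      case True
      then have len: "length b = q" by (simp add: bitstrings_def)
      have j: "j < q" using Suc.prems by (simp add: q_def)
      have "c ! j = False" using Suc.prems by (simp add: c_def nth_append)
      then have dc: "drop j c = False # drop (Suc j) c" using Cons_nth_drop_Suc[of j c] j len_c by simp
      have db: "drop j (b[j := v]) = v # drop (Suc j) b" for v
        using Cons_nth_drop_Suc[of j "b[j := v]"] j len by simp
      show ?thesis
        using app_op_hadamard[OF j True] True len by (simp add: dc db bitstrings_def \<sigma>_def)
    qed (simp add: app_op_def)
    then show ?case using Suc by auto
  qed
  have \<sigma>: "\<sigma> ^ N = complex_of_real (2 powr (- (real N / 2)))"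
  proof -
    have "(1 / sqrt 2) ^ N = 2 powr (- (real N / 2))"
      by (simp add: powr_minus powr_half_sqrt[symmetric] powr_realpow[symmetric] powr_powr
          power_one_over divide_simps)
    then show ?thesis unfolding \<sigma>_def by (metis of_real_1 of_real_divide of_real_power)
  qed
  show ?thesis
  proof
    fix b
    have "grover_init N k b = app_op q (hadamard N)
        (\<lambda>b. if b \<in> bitstrings q \<and> drop N b = drop N c then \<sigma> ^ N else 0) b"
      unfolding grover_init_def Let_def q_def[symmetric] init using part[of N] by simp
    also have "\<dots> = kickback_state N k (\<lambda>x. complex_of_real (2 powr (- (real N / 2)))) b"
    proof (cases "b \<in> bitstrings q")
      case True
      then have len: "length b = q" by (simp add: bitstrings_def)
      have N: "N < q" by (simp add: q_def)
      have dc: "drop N c = True # replicate k False" by (simp add: c_def)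
      have db: "drop N (b[N := v]) = v # drop (Suc N) b" for v
        using Cons_nth_drop_Suc[of N "b[N := v]"] N len by simp
      show ?thesis
        using app_op_hadamard[OF N True] True len
        by (auto simp: dc db bitstrings_def kickback_state_def q_def \<sigma>)
    qed (simp add: app_op_def kickback_state_def q_def)
    finally show "grover_init N k b =
        kickback_state N k (\<lambda>x. complex_of_real (2 powr (- (real N / 2)))) b" .
  qed
qed

text \<open>In the plane spanned by the normalised uniform superpositions over \<open>T\<close> and
  over its complement, one iteration is a rotation by \<open>2 * \<theta>\<close>. Giving the
  coordinates as products with the amplitudes covers \<open>T\<close> empty and \<open>T\<close>
  full without a division by zero.\<close>

lemma grover_state_amplitudes:
  assumes U: "quantum_oracle N T k U" and T: "T \<subseteq> bitstrings N"
  defines "\<theta> \<equiv> arcsin (sqrt (real (card T) / 2 ^ N))"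
  shows "\<exists>\<alpha> \<beta>. grover_state N k U L =
      kickback_state N k (\<lambda>x. complex_of_real (if x \<in> T then \<alpha> else \<beta>)) \<and>
    sqrt (real (card T)) * \<alpha> = sin (real (2 * L + 1) * \<theta>) \<and>
    sqrt (2 ^ N - real (card T)) * \<beta> = cos (real (2 * L + 1) * \<theta>)"
proof -
  define t where "t = real (card T)"
  define M :: real where "M = 2 ^ N"
  have M: "M > 0" by (simp add: M_def)
  have fin: "finite T" using T finite_bitstrings finite_subset by blast
  have "card T \<le> 2 ^ N" using card_mono[OF finite_bitstrings T] by (simp add: card_bitstrings)
  then have t: "0 \<le> t" "t \<le> M" unfolding t_def M_def using of_nat_mono by force+
  define s where "s = sqrt t / sqrt M"
  define c where "c = sqrt (M - t) / sqrt M"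
  have sin: "sin \<theta> = s"
  proof -
    have "sin \<theta> = sqrt (t / M)"
      unfolding \<theta>_def t_def[symmetric] M_def[symmetric] using t M
      by (intro sin_arcsin) (auto intro: order_trans[of _ 0])
    then show ?thesis by (simp add: s_def real_sqrt_divide)
  qed
  have cos: "cos \<theta> = c"
  proof -
    have "cos \<theta> = sqrt (1 - (sqrt (t / M))\<^sup>2)"
      unfolding \<theta>_def t_def[symmetric] M_def[symmetric] using t M
      by (intro cos_arcsin) (auto intro: order_trans[of _ 0])
    also have "\<dots> = sqrt ((M - t) / M)" using t M by (simp add: diff_divide_distrib)
    finally show ?thesis by (simp add: c_def real_sqrt_divide)
  qed
  have sM: "sqrt t = s * sqrt M" and cM: "sqrt (M - t) = c * sqrt M"
    using M by (simp_all add: s_def c_def)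
  have sc: "s\<^sup>2 + c\<^sup>2 = 1" using sin cos by (metis sin_cos_squared_add)
  have sum: "(\<Sum>x\<in>bitstrings N. complex_of_real (if x \<in> T then a else b)) =
      complex_of_real (t * a + (M - t) * b)" for a b
  proof -
    have "(\<Sum>x\<in>bitstrings N. if x \<in> T then a else b) = (\<Sum>x\<in>T. a) + (\<Sum>x\<in>bitstrings N - T. b)"
      using T fin finite_bitstrings[of N]
      by (simp add: sum.If_cases Int_absorb1 Diff_eq Int_absorb2 inf.absorb2)
    also have "\<dots> = t * a + (M - t) * b"
      using T fin \<open>card T \<le> 2 ^ N\<close>
      by (simp add: card_Diff_subset card_bitstrings t_def M_def of_nat_diff)
    finally show ?thesis by (simp only: of_real_sum[symmetric])
  qed
  have "\<exists>\<alpha> \<beta>. grover_state N k U L =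
      kickback_state N k (\<lambda>x. complex_of_real (if x \<in> T then \<alpha> else \<beta>)) \<and>
    sqrt t * \<alpha> = sin (real (2 * L + 1) * \<theta>) \<and>
    sqrt (M - t) * \<beta> = cos (real (2 * L + 1) * \<theta>)"
  proof (induction L)
    case 0
    have "2 powr (- (real N / 2)) = 1 / sqrt M"
      by (simp add: M_def powr_minus powr_half_sqrt[symmetric] powr_realpow[symmetric] powr_powr divide_simps)
    then show ?case
      using sin cos
      by (intro exI[of _ "1 / sqrt M"]) (simp add: grover_state_def grover_init_eq s_def c_def)
  next
    case (Suc L)
    then obtain a b where st: "grover_state N k U L =
        kickback_state N k (\<lambda>x. complex_of_real (if x \<in> T then a else b))"
      and a: "sqrt t * a = sin (real (2 * L + 1) * \<theta>)"
      and b: "sqrt (M - t) * b = cos (real (2 * L + 1) * \<theta>)" by blast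
    \<comment> \<open>Twice the mean amplitude after the sign change on \<open>T\<close>: the
      diffusion sends an amplitude \<open>z\<close> to \<open>\<mu> - z\<close>.\<close>
    define \<mu> where "\<mu> = 2 / M * (t * - a + (M - t) * b)"
    have "grover_state N k U (Suc L) = app_op (N + 1 + k) (on_first N (diffusion N))
        (app_op (N + 1 + k) U (grover_state N k U L))"
      by (simp add: grover_state_def Let_def)
    also have "\<dots> = app_op (N + 1 + k) (on_first N (diffusion N))
        (kickback_state N k (\<lambda>x. complex_of_real (if x \<in> T then - a else b)))"
      unfolding st app_op_oracle_kickback[OF U] by (intro arg_cong[where f = "app_op _ _"]
          arg_cong[where f = "kickback_state N k"] ext) simp
    also have "\<dots> = kickback_state N k (\<lambda>x. complex_of_real (if x \<in> T then \<mu> + a else \<mu> - b))"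
      unfolding app_op_diffusion_kickback sum
      by (intro arg_cong[where f = "kickback_state N k"] ext) (simp add: \<mu>_def M_def)
    finally have st': "grover_state N k U (Suc L) =
      kickback_state N k (\<lambda>x. complex_of_real (if x \<in> T then \<mu> + a else \<mu> - b))" .
    have \<mu>: "\<mu> = 2 / sqrt M * (- s * (sqrt t * a) + c * (sqrt (M - t) * b))"
    proof -
      have "t = s * sqrt M * sqrt t" "M - t = c * sqrt M * sqrt (M - t)"
        using t by (simp_all flip: sM cM)
      then have "t * - a + (M - t) * b = sqrt M * (- s * (sqrt t * a) + c * (sqrt (M - t) * b))"
        by algebra
      moreover have "2 / M * sqrt M = 2 / sqrt M" using M by (simp add: field_simps)
      ultimately show ?thesis unfolding \<mu>_def by (metis mult.assoc)
    qed
    have ang: "real (2 * Suc L + 1) * \<theta> = real (2 * L + 1) * \<theta> + 2 * \<theta>" by (simp add: algebra_simps)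
    have c2: "cos (2 * \<theta>) = 1 - 2 * s\<^sup>2" "cos (2 * \<theta>) = 2 * c\<^sup>2 - 1" and s2: "sin (2 * \<theta>) = 2 * s * c"
      using sc by (simp_all add: cos_double sin_double sin cos)
    have "sqrt t * (\<mu> + a) = 2 * s * (- s * (sqrt t * a) + c * (sqrt (M - t) * b)) + sqrt t * a"
      using M by (simp add: \<mu> distrib_left sM)
    also have "\<dots> = sin (real (2 * Suc L + 1) * \<theta>)"
      unfolding ang sin_add a b c2(1) s2 by (simp add: algebra_simps power2_eq_square)
    finally have 1: "sqrt t * (\<mu> + a) = sin (real (2 * Suc L + 1) * \<theta>)" .
    have "sqrt (M - t) * (\<mu> - b) =
        2 * c * (- s * (sqrt t * a) + c * (sqrt (M - t) * b)) - sqrt (M - t) * b"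
      using M by (simp add: \<mu> right_diff_distrib cM)
    also have "\<dots> = cos (real (2 * Suc L + 1) * \<theta>)"
      unfolding ang cos_add a b c2(2) s2 by (simp add: algebra_simps power2_eq_square)
    finally have 2: "sqrt (M - t) * (\<mu> - b) = cos (real (2 * Suc L + 1) * \<theta>)" .
    show ?case using st' 1 2 by blast
  qed
  then show ?thesis by (simp add: t_def M_def)
qed

text \<open>Outcome \<open>e\<close> collects two basis states, with target \<open>0\<close> or
  \<open>1\<close> and clean ancillas, each of weight \<open>(cmod (\<phi> e))\<^sup>2 / 2\<close>.
  Normalisation is what makes \<open>embed_pmf\<close> return this density.\<close>

lemma measure_kickback:
  assumes "(\<Sum>x\<in>bitstrings N. (cmod (\<phi> x))\<^sup>2) = 1"
  shows "pmf (measure_first N (N + 1 + k) (kickback_state N k \<phi>)) e =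
    (if e \<in> bitstrings N then (cmod (\<phi> e))\<^sup>2 else 0)"
proof -
  define f where "f e = (\<Sum>b\<in>{b \<in> bitstrings (N + 1 + k). take N b = e}.
    (cmod (kickback_state N k \<phi> b))\<^sup>2)" for e
  have f: "f e = (if e \<in> bitstrings N then (cmod (\<phi> e))\<^sup>2 else 0)" for e
  proof (cases "e \<in> bitstrings N")
    case True
    then have len: "length e = N" by (simp add: bitstrings_def)
    let ?S = "{e @ [False] @ replicate k False, e @ [True] @ replicate k False}"
    have "f e = (\<Sum>b\<in>?S. (cmod (kickback_state N k \<phi> b))\<^sup>2)"
      unfolding f_def
    proof (rule sum.mono_neutral_right)
      show "\<forall>b\<in>{b \<in> bitstrings (N + 1 + k). take N b = e} - ?S. (cmod (kickback_state N k \<phi> b))\<^sup>2 = 0"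
      proof (rule ballI, rule ccontr)
        fix b assume b: "b \<in> {b \<in> bitstrings (N + 1 + k). take N b = e} - ?S"
          and "(cmod (kickback_state N k \<phi> b))\<^sup>2 \<noteq> 0"
        then have "drop (Suc N) b = replicate k False" by (auto simp: kickback_state_def split: if_splits)
        moreover have "length b = N + 1 + k" using b by (simp add: bitstrings_def)
        ultimately have "b = e @ [b ! N] @ replicate k False" using b id_take_nth_drop[of N b] by simp
        then show False using b by (cases "b ! N") auto
      qed
      show "finite {b \<in> bitstrings (N + 1 + k). take N b = e}" using finite_bitstrings by simp
    qed (use len in \<open>auto simp: bitstrings_def\<close>)
    also have "\<dots> = (cmod (\<phi> e))\<^sup>2"
      using len by (simp add: kickback_state_def bitstrings_def nth_append norm_divide norm_mult power_divide)
    finally show ?thesis using True by simp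
  next
    case False
    then have "{b \<in> bitstrings (N + 1 + k). take N b = e} = {}" by (auto simp: bitstrings_def)
    then show ?thesis unfolding f_def using False by (simp only: sum.empty if_False)
  qed
  have "(\<integral>\<^sup>+ e. ennreal (f e) \<partial>count_space UNIV) = (\<Sum>e\<in>bitstrings N. ennreal (f e))"
    by (rule nn_integral_count_space') (auto simp: finite_bitstrings f)
  also have "\<dots> = ennreal (\<Sum>e\<in>bitstrings N. f e)" by (rule sum_ennreal) (simp add: f)
  also have "\<dots> = 1" using assms by (simp add: f)
  finally have "pmf (embed_pmf f) e = f e" by (intro pmf_embed_pmf) (auto simp: f)
  then show ?thesis using f[of e] unfolding measure_first_def f_def by simp
qed

lemma grover_outcome:
  assumes U: "quantum_oracle N T k U" and T: "T \<subseteq> bitstrings N"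
  shows "set_pmf (grover N k U L) \<subseteq> bitstrings N"
    and "measure_pmf.prob (grover N k U L) T =
      (sin (real (2 * L + 1) * arcsin (sqrt (real (card T) / 2 ^ N))))\<^sup>2"
proof -
  define \<theta> where "\<theta> = arcsin (sqrt (real (card T) / 2 ^ N))"
  obtain a b where st: "grover_state N k U L =
      kickback_state N k (\<lambda>x. complex_of_real (if x \<in> T then a else b))"
    and a: "sqrt (real (card T)) * a = sin (real (2 * L + 1) * \<theta>)"
    and b: "sqrt (2 ^ N - real (card T)) * b = cos (real (2 * L + 1) * \<theta>)"
    using grover_state_amplitudes[OF U T, of L] unfolding \<theta>_def by blast
  have fin: "finite T" using T finite_bitstrings finite_subset by blast
  have le: "card T \<le> 2 ^ N" using card_mono[OF finite_bitstrings T] by (simp add: card_bitstrings)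
  then have le': "real (card T) \<le> 2 ^ N" using of_nat_mono by force
  have a2: "real (card T) * a\<^sup>2 = (sin (real (2 * L + 1) * \<theta>))\<^sup>2"
    using arg_cong[OF a, of "\<lambda>z. z\<^sup>2"] by (simp add: power_mult_distrib)
  have b2: "(2 ^ N - real (card T)) * b\<^sup>2 = (cos (real (2 * L + 1) * \<theta>))\<^sup>2"
    using arg_cong[OF b, of "\<lambda>z. z\<^sup>2"] le' by (simp add: power_mult_distrib)
  have "(\<Sum>x\<in>bitstrings N. (cmod (complex_of_real (if x \<in> T then a else b)))\<^sup>2) =
      (\<Sum>x\<in>bitstrings N. if x \<in> T then a\<^sup>2 else b\<^sup>2)"
    by (intro sum.cong) auto
  also have "\<dots> = (\<Sum>x\<in>T. a\<^sup>2) + (\<Sum>x\<in>bitstrings N - T. b\<^sup>2)"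
    using T fin finite_bitstrings[of N]
    by (simp add: sum.If_cases Int_absorb1 Diff_eq Int_absorb2 inf.absorb2)
  also have "\<dots> = real (card T) * a\<^sup>2 + (2 ^ N - real (card T)) * b\<^sup>2"
    using T fin le by (simp add: card_Diff_subset card_bitstrings of_nat_diff)
  also have "\<dots> = 1" unfolding a2 b2 by simp
  finally have pmf: "pmf (grover N k U L) e = (if e \<in> bitstrings N
      then (cmod (complex_of_real (if e \<in> T then a else b)))\<^sup>2 else 0)" for e
    unfolding grover_def st by (rule measure_kickback)
  show "set_pmf (grover N k U L) \<subseteq> bitstrings N"
    by (auto simp: set_pmf_iff pmf split: if_splits)
  have "measure_pmf.prob (grover N k U L) T = (\<Sum>e\<in>T. pmf (grover N k U L) e)"
    by (rule measure_measure_pmf_finite[OF fin])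
  also have "\<dots> = (\<Sum>e\<in>T. a\<^sup>2)"
    using T by (intro sum.cong) (auto simp: pmf)
  finally show "measure_pmf.prob (grover N k U L) T =
      (sin (real (2 * L + 1) * arcsin (sqrt (real (card T) / 2 ^ N))))\<^sup>2"
    using a2 by (simp add: \<theta>_def)
qed

section \<open>Schedule and query count\<close>

lemma prob_bind_pmf:
  "measure_pmf.prob (bind_pmf p f) A = (\<integral>x. measure_pmf.prob (f x) A \<partial>measure_pmf p)"
  unfolding bind_pmf.rep_eq
  by (auto simp: measure_pmf.measure_bind[where N = "count_space UNIV"] measure_subprob)

lemma prob_replicate_pmf_none:
  "measure_pmf.prob (replicate_pmf M p) {xs. \<forall>x\<in>set xs. x \<notin> A} = measure_pmf.prob p (- A) ^ M"
proof (induction M)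
  case (Suc M)
  have "measure_pmf.prob (replicate_pmf M p \<bind> (\<lambda>xs. return_pmf (x # xs))) {xs. \<forall>x\<in>set xs. x \<notin> A} =
      indicator (- A) x * measure_pmf.prob p (- A) ^ M" for x
  proof -
    have "(#) x -` {xs. \<forall>x\<in>set xs. x \<notin> A} = (if x \<in> A then {} else {xs. \<forall>x\<in>set xs. x \<notin> A})"
      by auto
    then show ?thesis
      using Suc by (simp add: map_pmf_def[symmetric] measure_map_pmf)
  qed
  then show ?case by (simp add: prob_bind_pmf)
qed simp

lemma search_loop_output:
  assumes "\<omega> \<in> set_pmf (search_loop G check Ls a c)" "fst \<omega> = Some e"
  shows "check e \<and> (\<exists>L. e \<in> set_pmf (G L))"
  using assms by (induction Ls arbitrary: a c) (auto split: if_splits)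

text \<open>For each outcome of a round in \<open>pre\<close>, the loop has either succeeded or goes
  on to succeed with probability at least that of \<open>G L\<close>; averaging over the outcome
  preserves the bound. A round costs its number of iterations and one check, whence the length of
  \<open>pre\<close> in the budget.\<close>

lemma search_loop_prob_ge:
  assumes check: "\<And>L e. e \<in> set_pmf (G L) \<Longrightarrow> check e \<longleftrightarrow> e \<in> T"
  shows "measure_pmf.prob (G L) T \<le> measure_pmf.prob (search_loop G check (pre @ L # post) a c)
    {\<omega>. (\<exists>e\<in>T. fst \<omega> = Some e) \<and> queries \<omega> \<le> a + c + sum_list pre + length pre + L + 1}"
proof (induction pre arbitrary: a c)
  case Nil
  let ?A = "{\<omega>. (\<exists>e\<in>T. fst \<omega> = Some e) \<and> queries \<omega> \<le> a + c + L + 1}"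
  let ?f = "\<lambda>e. if check e then return_pmf (Some e, a + L, c + 1)
    else search_loop G check post (a + L) (c + 1)"
  have "measure_pmf.prob (G L) T = (\<integral>e. indicator T e \<partial>measure_pmf (G L))" by simp
  also have "\<dots> \<le> (\<integral>e. measure_pmf.prob (?f e) ?A \<partial>measure_pmf (G L))"
  proof (rule integral_mono_AE)
    show "AE e in measure_pmf (G L). indicator T e \<le> measure_pmf.prob (?f e) ?A"
      using check by (auto simp: AE_measure_pmf_iff indicator_def queries_def)
  qed (auto intro!: measure_pmf.integrable_const_bound[where B = 1])
  finally show ?case by (simp add: prob_bind_pmf)
next
  case (Cons L' pre)
  let ?n = "a + c + sum_list (L' # pre) + length (L' # pre) + L + 1"
  let ?A = "{\<omega>. (\<exists>e\<in>T. fst \<omega> = Some e) \<and> queries \<omega> \<le> ?n}"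
  let ?f = "\<lambda>e. if check e then return_pmf (Some e, a + L', c + 1)
    else search_loop G check (pre @ L # post) (a + L') (c + 1)"
  have "?n = (a + L') + (c + 1) + sum_list pre + length pre + L + 1" by simp
  then have IH: "measure_pmf.prob (G L) T \<le>
      measure_pmf.prob (search_loop G check (pre @ L # post) (a + L') (c + 1)) ?A"
    using Cons.IH[of "a + L'" "c + 1"] by (simp only:)
  have "measure_pmf.prob (G L) T = (\<integral>e. measure_pmf.prob (G L) T \<partial>measure_pmf (G L'))" by simp
  also have "\<dots> \<le> (\<integral>e. measure_pmf.prob (?f e) ?A \<partial>measure_pmf (G L'))"
  proof (rule integral_mono_AE)
    show "AE e in measure_pmf (G L'). measure_pmf.prob (G L) T \<le> measure_pmf.prob (?f e) ?A"
      using check IH by (auto simp: AE_measure_pmf_iff indicator_def queries_def)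
  qed (auto intro!: measure_pmf.integrable_const_bound[where B = 1])
  finally show ?case by (simp add: prob_bind_pmf)
qed

section \<open>Angles and iteration counts\<close>

lemma sin_squared_ge_half:
  fixes x :: real
  assumes "pi / 4 \<le> x" "x \<le> 3 * pi / 4"
  shows "1 / 2 \<le> (sin x)\<^sup>2"
proof -
  have "0 \<le> cos (pi - 2 * x)" using assms by (intro cos_ge_zero) auto
  then have "cos (2 * x) \<le> 0" by (simp add: cos_diff)
  then show ?thesis by (simp add: cos_double_sin)
qed

lemma sin_squared_ge_half_of_L_of_angle:
  assumes "0 < \<theta>" "\<theta> < pi / 8" "\<theta> / 2 \<le> \<theta>'" "\<theta>' \<le> \<theta>"
  shows "1 / 2 \<le> (sin (real (2 * L_of_angle \<theta> + 1) * \<theta>'))\<^sup>2"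
proof (rule sin_squared_ge_half)
  \<comment> \<open>\<open>y\<close> solves \<open>(2 * y + 1) * \<theta> = pi / 2\<close>. Passing
    to \<open>\<theta>' \<ge> \<theta> / 2\<close> keeps at least half of this, and rounding
    \<open>y\<close> up adds less than \<open>2 * \<theta> < pi / 4\<close>.\<close>
  define y where "y = pi / (4 * \<theta>) - 1 / 2"
  have L: "L_of_angle \<theta> = nat \<lceil>y\<rceil>" using assms by (simp add: L_of_angle_def y_def)
  have "pi / (4 * \<theta>) \<ge> 2" using assms by (simp add: field_simps)
  then have "y > 0" by (simp add: y_def)
  then have *: "y \<le> real (L_of_angle \<theta>)" "real (L_of_angle \<theta>) < y + 1" unfolding L by linarith+
  have "pi / 4 \<le> pi / (2 * \<theta>) * \<theta>'" using assms pi_gt_zero by (simp add: field_simps)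
  also have "pi / (2 * \<theta>) = 2 * y + 1" by (simp add: y_def)
  also have "(2 * y + 1) * \<theta>' \<le> real (2 * L_of_angle \<theta> + 1) * \<theta>'"
    using * assms by (intro mult_right_mono) auto
  finally show "pi / 4 \<le> real (2 * L_of_angle \<theta> + 1) * \<theta>'" .
  have "real (2 * L_of_angle \<theta> + 1) * \<theta>' \<le> (2 * y + 3) * \<theta>"
    using * assms \<open>y > 0\<close> by (intro mult_mono) auto
  also have "\<dots> = pi / 2 + 2 * \<theta>" using assms by (simp add: y_def field_simps)
  finally show "real (2 * L_of_angle \<theta> + 1) * \<theta>' \<le> 3 * pi / 4" using assms by simp
qed

lemma L_of_angle_less:
  assumes "0 < \<theta>" "\<theta> < pi / 8"
  shows "real (L_of_angle \<theta>) < pi / (4 * \<theta>) + 1 / 2"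
proof -
  have "pi / (4 * \<theta>) \<ge> 2" using assms by (simp add: field_simps)
  then show ?thesis using assms by (simp add: L_of_angle_def) linarith
qed

text \<open>Guesses \<open>K\<close> up to one sixteenth of \<open>2 ^ N\<close> have
  \<open>sin \<theta> \<le> 1 / 4\<close>, so their angles fall into the first branch of
  \<open>L_of_angle\<close>.\<close>

lemma sin_pi_eighth_gt: "1 / 4 < sin (pi / 8 :: real)"
proof -
  have "cos (2 * (pi / 8)) = sqrt 2 / 2" by (simp add: cos_45)
  then have "2 * (sin (pi / 8))\<^sup>2 = 1 - sqrt 2 / 2" unfolding cos_double_sin by simp
  moreover have "sqrt 2 < 3 / 2" by (rule real_less_lsqrt) (auto simp: power2_eq_square)
  ultimately have "(1 / 4)\<^sup>2 < (sin (pi / 8 :: real))\<^sup>2" by (simp add: power2_eq_square)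
  then show ?thesis by (rule power_less_imp_less_base) (auto intro!: sin_ge_zero)
qed

lemma arcsin_pos:
  assumes "0 < x" "x \<le> 1"
  shows "0 < arcsin x" "arcsin x \<le> pi / 2" "sin (arcsin x) = x" "x < 1 \<Longrightarrow> arcsin x < pi / 2"
  using assms arcsin_less_arcsin[of 0 x] arcsin_less_arcsin[of x 1] arcsin_bounded[of x] by auto

lemma angle_eq_arcsin:
  assumes "0 < K" "K < 2 ^ N"
  shows "angle N K = arcsin (sqrt (real K / 2 ^ N))"
    and "0 < angle N K" "angle N K < pi / 2" "sin (angle N K) = sqrt (real K / 2 ^ N)"
proof -
  let ?x = "sqrt (real K / 2 ^ N)"
  have "real K < 2 ^ N" using assms(2) of_nat_less_iff[of K "2 ^ N", where ?'a = real] by simp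
  then have x: "0 < ?x" "?x < 1" using assms by auto
  have *: "0 < arcsin ?x" "arcsin ?x < pi / 2" "sin (arcsin ?x) = ?x"
    using arcsin_pos[OF x(1) less_imp_le[OF x(2)]] x(2) by blast+
  show eq: "angle N K = arcsin ?x"
    unfolding angle_def
  proof (rule the_equality)
    show "\<theta> = arcsin ?x" if "0 < \<theta> \<and> \<theta> < pi / 2 \<and> sin \<theta> = ?x" for \<theta>
      using that arcsin_sin[of \<theta>] by auto
  qed (use * in auto)
  show "0 < angle N K" "angle N K < pi / 2" "sin (angle N K) = ?x" unfolding eq using * by auto
qed

lemma angle_less_pi_eighth:
  assumes "0 < K" "16 * K \<le> 2 ^ N"
  shows "angle N K < pi / 8" "sqrt (real K / 2 ^ N) \<le> angle N K" "0 < angle N K"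
proof -
  have K: "0 < K" "K < 2 ^ N" using assms by auto
  note a = angle_eq_arcsin[OF K]
  have "real K / 2 ^ N \<le> (1 / 4)\<^sup>2"
    using assms(2) of_nat_le_iff[of "16 * K" "2 ^ N", where ?'a = real]
    by (simp add: field_simps power2_eq_square)
  then have "sqrt (real K / 2 ^ N) \<le> 1 / 4" by (rule real_le_lsqrt[rotated]) auto
  then have "sin (angle N K) < sin (pi / 8)" using sin_pi_eighth_gt a by linarith
  then show "angle N K < pi / 8"
    using a by (subst (asm) sin_mono_less_eq) auto
  show "sqrt (real K / 2 ^ N) \<le> angle N K" using a sin_x_le_x[of "angle N K"] by simp
  show "0 < angle N K" by (rule a)
qed

text \<open>The added 1 is the check of the round. With \<open>w = 1 / sin \<theta>\<close>, the
  inequality \<open>sin \<theta> \<le> \<theta>\<close> gives \<open>L < pi / 4 * w + 1 / 2\<close>,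
  and \<open>w \<ge> 4\<close> absorbs the constants.\<close>

lemma L_of_angle_power_le:
  assumes "16 * 2 ^ j \<le> (2 ^ N :: nat)"
  shows "real (L_of_angle (angle N (2 ^ j))) + 1 \<le> 2 * sqrt (2 ^ N / 2 ^ j)"
proof -
  define \<theta> where "\<theta> = angle N (2 ^ j)"
  define w where "w = sqrt (2 ^ N / 2 ^ j)"
  have \<theta>: "\<theta> < pi / 8" "sqrt (2 ^ j / 2 ^ N) \<le> \<theta>" "0 < \<theta>"
    using angle_less_pi_eighth[of "2 ^ j" N] assms by (simp_all add: \<theta>_def)
  have w: "4 \<le> w"
    unfolding w_def using assms of_nat_le_iff[of "16 * 2 ^ j" "2 ^ N", where ?'a = real]
    by (intro real_le_rsqrt) (simp add: field_simps)
  have inv: "sqrt (2 ^ j / 2 ^ N) = 1 / w" by (simp add: w_def real_sqrt_divide)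
  have "pi / (4 * \<theta>) \<le> pi / (4 * (1 / w))"
    using \<theta> w inv pi_gt_zero by (intro divide_left_mono mult_left_mono) auto
  also have "\<dots> = pi / 4 * w" by simp
  also have "\<dots> \<le> 1 * w" using w pi_less_4 by (intro mult_right_mono) auto
  finally have "real (L_of_angle \<theta>) < w + 1 / 2" using L_of_angle_less[OF \<theta>(3,1)] by simp
  then show ?thesis using w unfolding \<theta>_def w_def by simp
qed

text \<open>Consecutive bounds shrink by \<open>1 / sqrt 2 \<le> 3 / 4\<close>, and 8 solves
  \<open>C = 2 + 3 / 4 * C\<close>. The induction descends from the empty sum because the dominant
  term has the smallest index.\<close>

lemma sum_geometric_sqrt_le:
  fixes g :: "nat \<Rightarrow> real"
  assumes "\<And>j. j < b \<Longrightarrow> g j \<le> 2 * sqrt (c / 2 ^ j)" "a \<le> b" "0 \<le> c"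
  shows "(\<Sum>j\<in>{a..<b}. g j) \<le> 8 * sqrt (c / 2 ^ a)"
  using assms(2)
proof (induction a rule: inc_induct)
  case base
  then show ?case using assms(3) by simp
next
  case (step a)
  define w where "w = sqrt (c / 2 ^ a)"
  have w: "0 \<le> w" using assms(3) by (simp add: w_def)
  have "sqrt (c / 2 ^ Suc a) = w / sqrt 2" by (simp add: w_def real_sqrt_divide real_sqrt_mult)
  moreover have "1 / sqrt 2 \<le> 3 / 4"
    using real_le_rsqrt[of "4 / 3" 2] by (simp add: field_simps power2_eq_square)
  then have "w / sqrt 2 \<le> 3 / 4 * w" using mult_left_mono[OF _ w, of "1 / sqrt 2" "3 / 4"] by simp
  ultimately have "(\<Sum>j\<in>{Suc a..<b}. g j) \<le> 6 * w" using step.IH by simp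
  moreover have "g a \<le> 2 * w" using assms(1)[of a] step.hyps by (simp add: w_def)
  ultimately show ?case using step.hyps by (simp add: sum.atLeast_Suc_lessThan w_def)
qed

lemma schedule_split:
  assumes "j < N - 3"
  shows "schedule N = ([0, 1, 2] @ map (\<lambda>i. L_of_angle (angle N (2 ^ i))) (rev [Suc j..<N - 3])) @
    L_of_angle (angle N (2 ^ j)) # map (\<lambda>i. L_of_angle (angle N (2 ^ i))) (rev [0..<j])"
proof -
  have "[0..<N - 3] = [0..<j] @ j # [Suc j..<N - 3]"
    using assms by (metis less_imp_add_positive upt_add_eq_append upt_conv_Cons zero_le less_imp_le_nat)
  then show ?thesis by (simp add: schedule_def)
qed

text \<open>If at least \<open>1/16\<close> of all strings are solutions, one of \<open>L = 0, 1, 2\<close> succeeds. Otherwise take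
  the guess \<open>K = 2\<^sup>j\<close> with \<open>2\<^bsup>j-1\<^esup> \<le> t < 2\<^sup>j\<close>: its angle \<open>\<theta>\<close> and the true angle
  \<open>\<theta>'\<close> satisfy \<open>\<theta>/2 \<le> \<theta>' \<le> \<theta> < \<pi>/8\<close>, so \<open>(2L+1)\<theta>'\<close> lies in
  \<open>[\<pi>/4, 3\<pi>/4]\<close>.\<close>
lemma good_schedule_entry:
  assumes t: "1 \<le> t" "t \<le> 2 ^ N"
  defines "\<theta>' \<equiv> arcsin (sqrt (real t / 2 ^ N))"
  shows "\<exists>pre L post. schedule N = pre @ L # post \<and> 1 / 2 \<le> (sin (real (2 * L + 1) * \<theta>'))\<^sup>2 \<and>
    real (sum_list pre + length pre + L + 1) \<le> 14 * sqrt (2 ^ N / real t)"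
proof -
  have t': "1 \<le> real t" "real t \<le> 2 ^ N" using t of_nat_mono by force+
  have ge1: "1 \<le> sqrt (2 ^ N / real t)" using t' by (simp add: field_simps)
  have x: "0 < sqrt (real t / 2 ^ N)" "sqrt (real t / 2 ^ N) \<le> 1" using t' by auto
  have \<theta>': "0 < \<theta>'" "\<theta>' \<le> pi / 2" "sin \<theta>' = sqrt (real t / 2 ^ N)"
    unfolding \<theta>'_def by (rule arcsin_pos[OF x])+
  have bnd: "real l \<le> 14 * sqrt (2 ^ N / real t)" if "l \<le> 14" for l
    using ge1 that by linarith
  show ?thesis
  proof (cases "2 ^ N \<le> 16 * t")
    case True
    have "2 ^ N \<le> 16 * real t" using True of_nat_le_iff[of "2 ^ N" "16 * t", where ?'a = real] by simp
    then have "1 / 4 \<le> sqrt (real t / 2 ^ N)" by (intro real_le_rsqrt) (simp add: field_simps power2_eq_square)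
    then have "1 / 4 \<le> \<theta>'" using sin_x_le_x[of \<theta>'] \<theta>' by simp
    then have "pi / 20 \<le> \<theta>'" using pi_less_4 by simp
    \<comment> \<open>For \<open>L = 0, 1, 2\<close> the angle is multiplied by 1, 3, 5, so it has
      to be at least \<open>pi / 4\<close>, \<open>pi / 12\<close>, \<open>pi / 20\<close>; at the
      upper end of each range the multiple is at most \<open>3 * pi / 4\<close>.\<close>
    then consider "pi / 4 \<le> \<theta>'" | "pi / 12 \<le> \<theta>'" "\<theta>' < pi / 4" | "pi / 20 \<le> \<theta>'" "\<theta>' < pi / 12" by linarith
    then show ?thesis
    proof cases
      case 1
      have "schedule N = [] @ 0 # tl (schedule N)" by (simp add: schedule_def)
      moreover have "1 / 2 \<le> (sin (real (2 * 0 + 1) * \<theta>'))\<^sup>2"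
        using 1 \<theta>' by (intro sin_squared_ge_half) auto
      moreover have "real (sum_list ([] :: nat list) + length ([] :: nat list) + 0 + 1) \<le> 14 * sqrt (2 ^ N / real t)"
        by (intro bnd) simp
      ultimately show ?thesis by blast
    next
      case 2
      have "schedule N = [0] @ 1 # tl (tl (schedule N))" by (simp add: schedule_def)
      moreover have "1 / 2 \<le> (sin (real (2 * 1 + 1) * \<theta>'))\<^sup>2"
        using 2 \<theta>' by (intro sin_squared_ge_half) auto
      moreover have "real (sum_list [0] + length [0] + 1 + 1) \<le> 14 * sqrt (2 ^ N / real t)"
        by (intro bnd) simp
      ultimately show ?thesis by blast
    next
      case 3
      have "schedule N = [0, 1] @ 2 # tl (tl (tl (schedule N)))" by (simp add: schedule_def)
      moreover have "1 / 2 \<le> (sin (real (2 * 2 + 1) * \<theta>'))\<^sup>2"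
        using 3 \<theta>' pi_gt_zero by (intro sin_squared_ge_half) auto
      moreover have "real (sum_list [0, 1] + length [0, 1] + 2 + 1) \<le> 14 * sqrt (2 ^ N / real t)"
        by (intro bnd) simp
      ultimately show ?thesis by blast
    qed
  next
    case False
    obtain i where i: "2 ^ i \<le> t" "t < 2 ^ Suc i" using ex_power_ivl1[of 2 t] t by auto
    define j where "j = Suc i"
    \<comment> \<open>Since \<open>2 ^ i \<le> t < 2 ^ N / 16\<close>, the next power
      \<open>2 ^ j\<close> is at most \<open>2 ^ (N - 4)\<close> and so occurs in the
      schedule.\<close>
    have "(2::nat) ^ (i + 4) < 2 ^ N" using False i(1) by (simp add: power_add)
    then have j: "j + 4 \<le> N" by (simp add: j_def)
    have small: "16 * 2 ^ l \<le> (2 ^ N :: nat)" if "l < N - 3" for l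
    proof -
      have "(2::nat) ^ (l + 4) \<le> 2 ^ N" using that by (intro power_increasing) auto
      then show ?thesis by (simp add: power_add)
    qed
    have jN: "j < N - 3" using j by simp
    define \<theta> where "\<theta> = angle N (2 ^ j)"
    note K = angle_less_pi_eighth[OF _ small[OF jN], folded \<theta>_def, simplified]
    have j2: "(2::nat) ^ j < 2 ^ N" using jN by simp
    note a = angle_eq_arcsin[OF _ j2, folded \<theta>_def, simplified]
    have tj: "real t \<le> 2 ^ j" using i(2) of_nat_le_iff[of t "2 ^ j", where ?'a = real] by (simp add: j_def)
    have jt: "2 ^ j \<le> 2 * real t" using i(1) of_nat_le_iff[of "2 ^ i" t, where ?'a = real] by (simp add: j_def)
    have "\<theta>' \<le> \<theta>"
    proof -
      have "sin \<theta>' \<le> sin \<theta>" using tj a \<theta>' by (simp add: divide_right_mono)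
      then show ?thesis using a \<theta>' by (subst (asm) sin_mono_le_eq) auto
    qed
    \<comment> \<open>The guess exceeds \<open>t\<close> by a factor of at most 2, hence
      \<open>sin \<theta>\<close> exceeds \<open>sin \<theta>'\<close> by at most
      \<open>sqrt 2\<close>. On the other hand
      \<open>sin \<theta> \<ge> sqrt 2 * sin (\<theta> / 2)\<close>, because
      \<open>cos (\<theta> / 2) \<ge> cos (pi / 4)\<close>.\<close>
    moreover have "\<theta> / 2 \<le> \<theta>'"
    proof -
      have "0 \<le> sin (\<theta> / 2)" using K pi_gt_zero by (intro sin_ge_zero) auto
      moreover have "sqrt 2 / 2 \<le> cos (\<theta> / 2)"
        using K pi_gt_zero cos_monotone_0_pi_le[of "\<theta> / 2" "pi / 4"] by (simp add: cos_45)
      ultimately have "sqrt 2 * sin (\<theta> / 2) \<le> 2 * sin (\<theta> / 2) * cos (\<theta> / 2)"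
        using mult_left_mono[of "sqrt 2 / 2" "cos (\<theta> / 2)" "2 * sin (\<theta> / 2)"] by (simp add: mult_ac)
      also have "\<dots> = sqrt (2 ^ j / 2 ^ N)" using sin_double[of "\<theta> / 2"] a by simp
      also have "\<dots> \<le> sqrt (2 * (real t / 2 ^ N))" using jt by (simp add: divide_right_mono)
      also have "\<dots> = sqrt 2 * sin \<theta>'" unfolding \<theta>' by (rule real_sqrt_mult)
      finally have "sin (\<theta> / 2) \<le> sin \<theta>'" by simp
      then show ?thesis using K \<theta>' pi_gt_zero by (subst (asm) sin_mono_le_eq) auto
    qed
    ultimately have half: "1 / 2 \<le> (sin (real (2 * L_of_angle \<theta> + 1) * \<theta>'))\<^sup>2"
      using K by (intro sin_squared_ge_half_of_L_of_angle) auto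
    define g where "g l = L_of_angle (angle N (2 ^ l))" for l
    define pre where "pre = [0, 1, 2] @ map g (rev [Suc j..<N - 3])"
    \<comment> \<open>The 6 is the cost of the rounds \<open>L = 0, 1, 2\<close>: three oracle
      queries and three checks. With the factor 8 of the geometric sum it makes the 14 of the
      bound.\<close>
    have "sum_list pre + length pre + L_of_angle \<theta> + 1 = 6 + (\<Sum>l\<in>{j..<N - 3}. g l + 1)"
    proof -
      have "sum_list (map g (rev [Suc j..<N - 3])) = (\<Sum>l\<in>{Suc j..<N - 3}. g l)"
        by (simp add: rev_map[symmetric] sum_list_rev sum_list_distinct_conv_sum_set)
      then have "sum_list pre + length pre = 6 + (\<Sum>l\<in>{Suc j..<N - 3}. g l + 1)"
        by (simp add: pre_def sum_Suc)
      then show ?thesis using jN by (simp add: sum.atLeast_Suc_lessThan g_def \<theta>_def)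
    qed
    also have "real \<dots> = 6 + (\<Sum>l\<in>{j..<N - 3}. real (g l) + 1)" by (simp add: add.commute)
    also have "\<dots> \<le> 6 + 8 * sqrt (2 ^ N / 2 ^ j)"
      using jN L_of_angle_power_le[OF small] unfolding g_def
      by (intro add_left_mono sum_geometric_sqrt_le) auto
    also have "\<dots> \<le> 6 + 8 * sqrt (2 ^ N / real t)"
      using t' tj by (intro add_left_mono mult_left_mono real_sqrt_le_mono divide_left_mono) auto
    finally have "real (sum_list pre + length pre + L_of_angle \<theta> + 1) \<le> 14 * sqrt (2 ^ N / real t)"
      using ge1 by linarith
    then show ?thesis using half schedule_split[OF jN] unfolding pre_def g_def \<theta>_def by blast
  qed
qed

section \<open>The factorial against the query rate\<close>

lemma power_le_fact_mult_exp:
  fixes x :: real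
  assumes "0 \<le> x"
  shows "x ^ s \<le> fact s * exp x"
proof -
  have "(\<Sum>n\<in>{s}. x ^ n /\<^sub>R fact n) \<le> (\<Sum>n. x ^ n /\<^sub>R fact n)"
    using assms exp_converges[of x] by (intro sum_le_suminf) (auto simp: sums_iff)
  also have "\<dots> = exp x" using exp_converges[of x] by (simp add: sums_iff)
  finally show ?thesis by (simp add: field_simps)
qed

text \<open>For \<open>x > 1\<close> the exponent may be raised to the integer \<open>s\<close>, and
  \<open>x ^ s / fact s\<close> is a single term of the series of \<open>exp x\<close>. For
  \<open>x \<le> 1\<close> the base \<open>x / exp 1\<close> is below 1.\<close>

lemma powr_self_le_fact:
  assumes "0 < x" "x \<le> real s"
  shows "(x / exp 1) powr x \<le> fact s"
proof (cases "x \<le> 1")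
  case True
  have "(x / exp 1) powr x \<le> 1 powr x"
    using assms True by (intro powr_mono2) (auto simp: field_simps intro: order_trans[of _ 1])
  also have "\<dots> \<le> fact s" by (simp add: fact_ge_1)
  finally show ?thesis .
next
  case False
  have "(x / exp 1) powr x = x powr x / exp x" using assms by (simp add: powr_divide powr_def[of "exp 1"])
  also have "x powr x \<le> x powr real s" using assms False by (intro powr_mono) auto
  also have "x powr real s = x ^ s" using assms by (simp add: powr_realpow)
  also have "x ^ s \<le> fact s * exp x" using assms by (intro power_le_fact_mult_exp) simp
  finally show ?thesis by (simp add: divide_right_mono)
qed

text \<open>From \<open>sqrt N \<le> n\<close> follows \<open>x \<le> n - m\<close>, which makes
  \<open>powr_self_le_fact\<close> applicable; the square root halves the exponent. For
  \<open>x \<le> 0\<close> the bound is \<open>t \<ge> 1\<close>.\<close>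

lemma sqrt_ratio_le_query_rate:
  assumes "fact (n - m) \<le> t" "m \<le> n"
  shows "sqrt (2 ^ num_pairs n / real t) \<le> query_rate (num_pairs n) m"
proof -
  define N where "N = num_pairs n"
  define x where "x = sqrt (real N) - real m"
  have ft: "fact (n - m) \<le> real t" using assms(1) of_nat_le_iff[of "fact (n - m)" t, where ?'a = real] by simp
  then have t1: "1 \<le> real t" using fact_ge_1[of "n - m", where ?'a = real] by linarith
  have two: "sqrt (2 ^ N) = 2 powr (real N / 2)"
    by (simp add: powr_half_sqrt[symmetric] powr_realpow[symmetric] powr_powr)
  have "1 / sqrt (real t) \<le> (if x > 0 then (x / exp 1) powr (- (x / 2)) else 1)"
  proof (cases "x > 0")
    case True
    have "N \<le> n * n" unfolding N_def num_pairs_def by (metis diff_le_self div_le_dividend mult_le_mono2 order_trans)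
    then have "real N \<le> (real n)\<^sup>2" using of_nat_mono[of N "n * n", where ?'a = real] by (simp add: power2_eq_square)
    then have "sqrt (real N) \<le> real n" by (rule real_le_lsqrt[rotated]) auto
    then have "(x / exp 1) powr x \<le> fact (n - m)"
      using True assms(2) by (intro powr_self_le_fact) (auto simp: x_def of_nat_diff)
    then have "sqrt ((x / exp 1) powr x) \<le> sqrt (real t)" using ft by simp
    moreover have "sqrt ((x / exp 1) powr x) = (x / exp 1) powr (x / 2)"
      using True by (simp add: powr_half_sqrt[symmetric] powr_powr)
    ultimately show ?thesis using True by (simp add: powr_minus divide_simps)
  qed (use t1 in simp)
  then have "sqrt (2 ^ N) * (1 / sqrt (real t)) \<le> query_rate N m"
    unfolding query_rate_def Let_def x_def[symmetric] two by (intro mult_left_mono) auto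
  then show ?thesis by (simp add: N_def real_sqrt_divide)
qed

section \<open>Soundness and success probability of the algorithm\<close>

lemma solutions_subset: "solutions n m d0 \<subseteq> bitstrings (num_pairs n)"
  by (auto simp: solutions_def)

lemma algorithm_A_sound:
  assumes "quantum_oracle (num_pairs n) (solutions n m d0) k U"
    and "\<omega> \<in> set_pmf (algorithm_A n m d0 k U)" "fst \<omega> = Some e"
  shows "e \<in> bitstrings (num_pairs n)" "classical_check n m d0 e"
  using search_loop_output[OF assms(2)[unfolded algorithm_A_def] assms(3)]
    grover_outcome(1)[OF assms(1) solutions_subset] by blast+

lemma algorithm_A_success:
  assumes U: "quantum_oracle (num_pairs n) (solutions n m d0) k U" and adm: "admits_solution n m d0"
  shows "1 / 2 \<le> measure_pmf.prob (algorithm_A n m d0 k U)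
    {\<omega>. finds_solution n m d0 \<omega> \<and> real (queries \<omega>) \<le> 14 * query_rate (num_pairs n) m}"
proof -
  define N where "N = num_pairs n"
  define T where "T = solutions n m d0"
  note fact_le = card_solutions_ge_fact[OF adm]
  have "1 \<le> card T" unfolding T_def by (rule order_trans[OF fact_ge_1 fact_le(1)])
  moreover have "card T \<le> 2 ^ N"
    using card_mono[OF finite_bitstrings solutions_subset] by (simp add: card_bitstrings T_def N_def)
  ultimately obtain pre L post where split: "schedule N = pre @ L # post"
    and half: "1 / 2 \<le> (sin (real (2 * L + 1) * arcsin (sqrt (real (card T) / 2 ^ N))))\<^sup>2"
    and bound: "real (sum_list pre + length pre + L + 1) \<le> 14 * sqrt (2 ^ N / real (card T))"
    using good_schedule_entry[of "card T" N] by blast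
  have rate: "real (sum_list pre + length pre + L + 1) \<le> 14 * query_rate N m"
    using bound sqrt_ratio_le_query_rate[OF fact_le] unfolding T_def N_def by linarith
  have chk: "classical_check n m d0 e \<longleftrightarrow> e \<in> T" if "e \<in> set_pmf (grover N k U L)" for L e
    using grover_outcome(1)[OF U solutions_subset] that classical_check_iff[of e n m d0]
    unfolding N_def T_def by blast
  have "1 / 2 \<le> measure_pmf.prob (grover N k U L) T"
    using half grover_outcome(2)[OF U solutions_subset, of L] by (simp add: N_def T_def)
  also have "\<dots> \<le> measure_pmf.prob (algorithm_A n m d0 k U)
      {\<omega>. (\<exists>e\<in>T. fst \<omega> = Some e) \<and> queries \<omega> \<le> 0 + 0 + sum_list pre + length pre + L + 1}"
    unfolding algorithm_A_def N_def[symmetric] split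
    by (rule search_loop_prob_ge) (rule chk)
  also have "\<dots> \<le> measure_pmf.prob (algorithm_A n m d0 k U)
      {\<omega>. finds_solution n m d0 \<omega> \<and> real (queries \<omega>) \<le> 14 * query_rate N m}"
  proof (rule measure_pmf.finite_measure_mono)
    show "{\<omega>. (\<exists>e\<in>T. fst \<omega> = Some e) \<and> queries \<omega> \<le> 0 + 0 + sum_list pre + length pre + L + 1} \<subseteq>
        {\<omega>. finds_solution n m d0 \<omega> \<and> real (queries \<omega>) \<le> 14 * query_rate N m}"
    proof safe
      fix \<omega> :: run and e assume "e \<in> T" "fst \<omega> = Some e"
      then show "finds_solution n m d0 \<omega>" by (auto simp: finds_solution_def T_def)
    next
      fix \<omega> :: run assume "queries \<omega> \<le> 0 + 0 + sum_list pre + length pre + L + 1"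
      then have "real (queries \<omega>) \<le> real (sum_list pre + length pre + L + 1)" by linarith
      then show "real (queries \<omega>) \<le> 14 * query_rate N m" using rate by linarith
    qed
  qed simp
  finally show ?thesis by (simp add: N_def)
qed

lemma repeated_algorithm_A_success:
  assumes U: "quantum_oracle (num_pairs n) (solutions n m d0) k U" and adm: "admits_solution n m d0"
    and \<delta>: "0 < \<delta>" "log 2 (inverse \<delta>) < real M"
  shows "1 - \<delta> < measure_pmf.prob (replicate_pmf M (algorithm_A n m d0 k U))
    {\<omega>s. \<exists>\<omega>\<in>set \<omega>s. finds_solution n m d0 \<omega>}"
proof -
  define A where "A = {\<omega>. finds_solution n m d0 \<omega>}"
  define P where "P = algorithm_A n m d0 k U"
  have "1 / 2 \<le> measure_pmf.prob P
      {\<omega>. finds_solution n m d0 \<omega> \<and> real (queries \<omega>) \<le> 14 * query_rate (num_pairs n) m}"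
    unfolding P_def by (rule algorithm_A_success[OF U adm])
  also have "\<dots> \<le> measure_pmf.prob P A"
    unfolding A_def by (rule measure_pmf.finite_measure_mono) auto
  finally have "measure_pmf.prob P (- A) \<le> 1 / 2"
    using measure_pmf.prob_compl[of A P] by (simp add: Compl_eq_Diff_UNIV)
  then have "measure_pmf.prob P (- A) ^ M \<le> (1 / 2) ^ M" by (intro power_mono) auto
  also have "\<dots> < \<delta>"
  proof -
    have "inverse \<delta> < 2 powr real M" using \<delta> by (simp add: log_less_iff)
    then show ?thesis using \<delta>(1) by (simp add: powr_realpow power_one_over field_simps)
  qed
  finally have "measure_pmf.prob (replicate_pmf M P) {\<omega>s. \<forall>\<omega>\<in>set \<omega>s. \<omega> \<notin> A} < \<delta>"
    by (simp add: prob_replicate_pmf_none)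
  moreover have "{\<omega>s. \<exists>\<omega>\<in>set \<omega>s. finds_solution n m d0 \<omega>} = UNIV - {\<omega>s. \<forall>\<omega>\<in>set \<omega>s. \<omega> \<notin> A}"
    by (auto simp: A_def)
  ultimately show ?thesis
    using measure_pmf.prob_compl[of "{\<omega>s. \<forall>\<omega>\<in>set \<omega>s. \<omega> \<notin> A}" "replicate_pmf M P"]
    by (simp add: P_def)
qed

section \<open>Reversible circuits\<close>

text \<open>A gate on an abstract set of wires is given by its controls and its target; with zero, one or
  two controls it is NOT, CNOT or CCNOT.\<close>
type_synonym 'w cgate = "'w list \<times> 'w"

definition cgate_ok :: "'w cgate \<Rightarrow> bool" where
  "cgate_ok g \<longleftrightarrow> distinct (fst g) \<and> snd g \<notin> set (fst g) \<and> length (fst g) \<le> 2"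

definition gate_act :: "'w cgate \<Rightarrow> ('w \<Rightarrow> bool) \<Rightarrow> 'w \<Rightarrow> bool" where
  "gate_act g s = s(snd g := (s (snd g) \<noteq> (\<forall>c\<in>set (fst g). s c)))"

definition run_gates :: "'w cgate list \<Rightarrow> ('w \<Rightarrow> bool) \<Rightarrow> 'w \<Rightarrow> bool" where
  "run_gates gs = fold gate_act gs"

definition gates_on :: "'w set \<Rightarrow> 'w cgate list \<Rightarrow> bool" where
  "gates_on W gs \<longleftrightarrow> (\<forall>g\<in>set gs. cgate_ok g \<and> snd g \<in> W \<and> set (fst g) \<subseteq> W)"

lemma run_gates_simps [simp]:
  "run_gates [] s = s"
  "run_gates (g # gs) s = run_gates gs (gate_act g s)"
  "run_gates (gs @ gs') s = run_gates gs' (run_gates gs s)"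
  by (simp_all add: run_gates_def)

lemma gates_on_simps [simp]:
  "gates_on W []"
  "gates_on W (g # gs) \<longleftrightarrow> cgate_ok g \<and> snd g \<in> W \<and> set (fst g) \<subseteq> W \<and> gates_on W gs"
  "gates_on W (gs @ gs') \<longleftrightarrow> gates_on W gs \<and> gates_on W gs'"
  "gates_on W (rev gs) \<longleftrightarrow> gates_on W gs"
  "gates_on W (concat gss) \<longleftrightarrow> (\<forall>gs\<in>set gss. gates_on W gs)"
  by (auto simp: gates_on_def)

lemma gates_on_mono: "gates_on W gs \<Longrightarrow> W \<subseteq> W' \<Longrightarrow> gates_on W' gs"
  by (auto simp: gates_on_def)

lemma gate_act_involution: "cgate_ok g \<Longrightarrow> gate_act g (gate_act g s) = s"
proof -
  assume "cgate_ok g"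
  then have "\<forall>c\<in>set (fst g). gate_act g s c = s c" by (auto simp: gate_act_def cgate_ok_def)
  then show ?thesis unfolding gate_act_def[of g "gate_act g s"] by (auto simp: gate_act_def fun_eq_iff)
qed

lemma run_gates_rev: "gates_on W gs \<Longrightarrow> run_gates (rev gs) (run_gates gs s) = s"
  by (induction gs arbitrary: s) (auto simp: gate_act_involution)

text \<open>A wire outside \<open>W\<close> neither controls nor receives a gate, so changing it
  commutes with the circuit. This lets a copied bit pass through the reversed gates
  unharmed.\<close>

lemma run_gates_upd:
  "gates_on W gs \<Longrightarrow> t \<notin> W \<Longrightarrow> run_gates gs (s(t := v)) = (run_gates gs s)(t := v)"
proof (induction gs arbitrary: s)
  case (Cons g gs)
  then have "(\<forall>c\<in>set (fst g). (s(t := v)) c) \<longleftrightarrow> (\<forall>c\<in>set (fst g). s c)" and "snd g \<noteq> t"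
    by (auto intro!: ball_cong)
  then have "gate_act g (s(t := v)) = (gate_act g s)(t := v)"
    unfolding gate_act_def by (simp add: fun_upd_twist)
  moreover have "run_gates gs ((gate_act g s)(t := v)) = (run_gates gs (gate_act g s))(t := v)"
    using Cons.prems by (intro Cons.IH) simp_all
  ultimately show ?case by (simp only: run_gates_simps)
qed simp

lemma run_gates_outside: "gates_on W gs \<Longrightarrow> t \<notin> W \<Longrightarrow> run_gates gs s t = s t"
  using run_gates_upd[of W gs t s "s t"] by (metis fun_upd_same fun_upd_triv)

definition compute_copy_uncompute :: "'w cgate list \<Rightarrow> 'w \<Rightarrow> 'w \<Rightarrow> 'w cgate list" where
  "compute_copy_uncompute gs c t = gs @ [([c], t)] @ rev gs"

lemma gates_on_compute_copy_uncompute: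
  "gates_on W gs \<Longrightarrow> c \<in> W \<Longrightarrow> t \<notin> W \<Longrightarrow> gates_on (insert t W) (compute_copy_uncompute gs c t)"
  by (auto simp: compute_copy_uncompute_def cgate_ok_def intro: gates_on_mono)

text \<open>Bennett's trick: the copying gate alters only \<open>t\<close>, which the gates
  \<open>gs\<close> do not touch, so reversing them still undoes the computation. All wires of
  \<open>W\<close> can be reused as work space.\<close>

lemma run_compute_copy_uncompute:
  assumes "gates_on W gs" "c \<in> W" "t \<notin> W"
  shows "run_gates (compute_copy_uncompute gs c t) s = s(t := (s t \<noteq> run_gates gs s c))"
proof -
  have "gate_act ([c], t) (run_gates gs s) = (run_gates gs s)(t := (s t \<noteq> run_gates gs s c))"
    using assms by (simp add: gate_act_def run_gates_outside)
  moreover have "gates_on W (rev gs)" using assms by simp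
  ultimately show ?thesis
    using run_gates_upd[of W "rev gs" t "run_gates gs s"] assms(3) run_gates_rev[OF assms(1)]
    by (simp add: compute_copy_uncompute_def)
qed

lemma length_compute_copy_uncompute:
  "length (compute_copy_uncompute gs c t) = 2 * length gs + 1"
  by (simp add: compute_copy_uncompute_def)

text \<open>\<open>Pass b\<close> records that all distances from the terminals \<open>1, \<dots>, b\<close> are as prescribed;
  \<open>Conj i\<close> is the conjunction of the first \<open>i\<close> literals of a list.\<close>
datatype wire = Adj nat | Target | Reach nat nat | Arrive nat | Conj nat | Pass nat

section \<open>Conjunctions of literals\<close>

fun conj_chain :: "nat \<Rightarrow> (wire \<times> bool) list \<Rightarrow> wire cgate list" where
  "conj_chain i [] = []"
| "conj_chain i ((w, p) # ls) = (if p then [] else [([], w)]) @ [([w, Conj i], Conj (Suc i))] @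
     (if p then [] else [([], w)]) @ conj_chain (Suc i) ls"

definition conj_gates :: "(wire \<times> bool) list \<Rightarrow> wire cgate list" where
  "conj_gates ls = ([], Conj 0) # conj_chain 0 ls"

text \<open>As a gate has at most two controls, the conjunction is accumulated one literal at a
  time. A negative literal is inverted before its gate and restored after it. The wires
  \<open>Conj j\<close> beyond \<open>i\<close> start at \<open>0\<close>, so that toggling amounts
  to writing.\<close>

lemma run_conj_chain:
  assumes "fst ` set ls \<inter> range Conj = {}" "\<And>j. i < j \<Longrightarrow> \<not> s (Conj j)"
  shows "run_gates (conj_chain i ls) s (Conj (i + length ls)) \<longleftrightarrow>
    s (Conj i) \<and> (\<forall>(w, p)\<in>set ls. s w = p)"
  using assms
proof (induction ls arbitrary: i s)
  case (Cons l ls)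
  obtain w p where l: "l = (w, p)" by fastforce
  define s' where "s' = s(Conj (Suc i) := (s (Conj i) \<and> s w = p))"
  have w: "w \<noteq> Conj j" for j using Cons.prems(1) l by auto
  have "run_gates (conj_chain i (l # ls)) s = run_gates (conj_chain (Suc i) ls) s'"
    using w w[symmetric] Cons.prems(2)[of "Suc i"]
    by (cases p) (simp_all add: l s'_def gate_act_def fun_upd_twist conj_commute)
  moreover have "run_gates (conj_chain (Suc i) ls) s' (Conj (Suc i + length ls)) \<longleftrightarrow>
      s' (Conj (Suc i)) \<and> (\<forall>(w, p)\<in>set ls. s' w = p)"
    using Cons.prems by (intro Cons.IH) (auto simp: s'_def)
  moreover have "s' w' = s w'" if "(w', p') \<in> set ls" for w' p'
    using Cons.prems(1) that by (force simp: s'_def)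
  ultimately show ?case by (auto simp: l s'_def)
qed simp

lemma run_conj_gates:
  assumes "fst ` set ls \<inter> range Conj = {}" "\<And>j. \<not> s (Conj j)"
  shows "run_gates (conj_gates ls) s (Conj (length ls)) \<longleftrightarrow> (\<forall>(w, p)\<in>set ls. s w = p)"
proof -
  define s' where "s' = s(Conj 0 := True)"
  have "run_gates (conj_gates ls) s = run_gates (conj_chain 0 ls) s'"
    using assms(2) by (simp add: conj_gates_def gate_act_def s'_def)
  moreover have "run_gates (conj_chain 0 ls) s' (Conj (0 + length ls)) \<longleftrightarrow>
      s' (Conj 0) \<and> (\<forall>(w, p)\<in>set ls. s' w = p)"
    using assms by (intro run_conj_chain) (auto simp: s'_def)
  moreover have "s' w' = s w'" if "(w', p') \<in> set ls" for w' p'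
    using assms(1) that by (force simp: s'_def)
  ultimately show ?thesis by (auto simp: s'_def)
qed

lemma gates_on_conj_chain:
  assumes "fst ` set ls \<inter> range Conj = {}" "fst ` set ls \<subseteq> W" "Conj ` {i..i + length ls} \<subseteq> W"
  shows "gates_on W (conj_chain i ls)"
  using assms
proof (induction ls arbitrary: i)
  case (Cons l ls)
  have "gates_on W (conj_chain (Suc i) ls)" using Cons.prems by (intro Cons.IH) auto
  moreover have "Conj i \<in> W" "Conj (Suc i) \<in> W" using Cons.prems(3) by auto
  ultimately show ?case using Cons.prems(1,2) by (cases l) (auto simp: cgate_ok_def)
qed simp

lemma gates_on_conj_gates:
  assumes "fst ` set ls \<inter> range Conj = {}" "fst ` set ls \<subseteq> W" "Conj ` {..length ls} \<subseteq> W"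
  shows "gates_on W (conj_gates ls)"
proof -
  have "gates_on W (conj_chain 0 ls)"
    using assms by (intro gates_on_conj_chain) (auto simp: atLeast0AtMost)
  then show ?thesis using assms(3) by (auto simp: conj_gates_def cgate_ok_def)
qed

lemma length_conj_gates: "length (conj_gates ls) \<le> 1 + 3 * length ls"
proof -
  have "length (conj_chain i ls) \<le> 3 * length ls" for i
    by (induction i ls rule: conj_chain.induct) auto
  then show ?thesis by (simp add: conj_gates_def)
qed

section \<open>Breadth-first search from one terminal\<close>

definition pair_index :: "nat \<Rightarrow> nat \<Rightarrow> nat \<Rightarrow> nat" where
  "pair_index n u v = (SOME i. i < num_pairs n \<and> (\<forall>e. {u, v} \<in> edges_of n e \<longleftrightarrow> e ! i))"

lemma pair_index:
  assumes "u \<in> {1..n}" "v \<in> {1..n}" "u \<noteq> v"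
  shows "pair_index n u v < num_pairs n" "e ! pair_index n u v \<longleftrightarrow> {u, v} \<in> edges_of n e"
  using someI_ex[OF ex_pair_index[OF assms]] unfolding pair_index_def by blast+

text \<open>\<open>Reach l v\<close> is to hold the bit ``\<open>v\<close> is within distance \<open>l\<close> of the source'', which is the
  disjunction over \<open>u\<close> of the bits \<open>Arrive u\<close>: ``\<open>v\<close> is equal or adjacent to \<open>u\<close>, and \<open>u\<close> is within
  distance \<open>l - 1\<close>''.\<close>
definition reach_compute :: "nat \<Rightarrow> nat \<Rightarrow> nat \<Rightarrow> wire cgate list" where
  "reach_compute n l v =
     map (\<lambda>u. (if u = v then [Reach l u] else [Reach l u, Adj (pair_index n u v)], Arrive u)) [1..<Suc n] @
     conj_gates (map (\<lambda>u. (Arrive u, False)) [1..<Suc n])"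

text \<open>De Morgan: the literals of \<open>reach_compute\<close> are all negative, so
  \<open>Conj n\<close> holds the negated disjunction, and the closing NOT corrects the copied
  bit.\<close>

definition reach_gates :: "nat \<Rightarrow> nat \<Rightarrow> nat \<Rightarrow> wire cgate list" where
  "reach_gates n l v = compute_copy_uncompute (reach_compute n l v) (Conj n) (Reach (Suc l) v) @
     [([], Reach (Suc l) v)]"

definition bfs_gates :: "nat \<Rightarrow> nat \<Rightarrow> wire cgate list" where
  "bfs_gates n d = concat (map (\<lambda>l. concat (map (reach_gates n l) [1..<Suc n])) [0..<d])"

text \<open>The conjunction wires are shared. The longest list, \<open>distance_literals\<close>,
  has \<open>n * m + 1\<close> entries, which \<open>n * n + 1\<close> covers for
  \<open>m \<le> n\<close>.\<close>

definition base_wires :: "nat \<Rightarrow> wire set" where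
  "base_wires n = Adj ` {..<num_pairs n} \<union> Arrive ` {1..n} \<union> Conj ` {..n * n + 1}"

lemma Conj_in_base_wires: "Conj n \<in> base_wires n" "Conj ` {..n} \<subseteq> base_wires n"
proof -
  have "n \<le> n * n + 1" by (rule trans_le_add1[OF le_square])
  then have "Conj ` {..n} \<subseteq> Conj ` {..n * n + 1}" by (intro image_mono) simp
  then show *: "Conj ` {..n} \<subseteq> base_wires n" unfolding base_wires_def by blast
  then show "Conj n \<in> base_wires n" by blast
qed

lemma gates_on_reach_compute:
  assumes "v \<in> {1..n}"
  shows "gates_on (base_wires n \<union> Reach l ` {1..n}) (reach_compute n l v)"
proof -
  let ?W = "base_wires n \<union> Reach l ` {1..n}"
  have "gates_on ?W (map (\<lambda>u. (if u = v then [Reach l u] else [Reach l u, Adj (pair_index n u v)], Arrive u))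
      [1..<Suc n])"
    using assms pair_index(1)[of _ n v] by (auto simp: gates_on_def cgate_ok_def base_wires_def simp del: upt_Suc)
  moreover have "gates_on ?W (conj_gates (map (\<lambda>u. (Arrive u, False)) [1..<Suc n]))"
    using Conj_in_base_wires(2)[of n]
    by (intro gates_on_conj_gates) (auto simp: base_wires_def simp del: upt_Suc)
  ultimately show ?thesis unfolding reach_compute_def by simp
qed

lemma gates_on_reach_gates:
  assumes "v \<in> {1..n}"
  shows "gates_on (base_wires n \<union> Reach l ` {1..n} \<union> {Reach (Suc l) v}) (reach_gates n l v)"
proof -
  let ?W = "base_wires n \<union> Reach l ` {1..n}"
  have "gates_on (insert (Reach (Suc l) v) ?W)
      (compute_copy_uncompute (reach_compute n l v) (Conj n) (Reach (Suc l) v))"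
    by (rule gates_on_compute_copy_uncompute[OF gates_on_reach_compute[OF assms]])
      (use Conj_in_base_wires(1) in \<open>auto simp: base_wires_def\<close>)
  then show ?thesis unfolding reach_gates_def by (simp add: cgate_ok_def)
qed

lemma gates_on_bfs_gates:
  "gates_on (base_wires n \<union> (\<Union>l\<in>{..d}. Reach l ` {1..n})) (bfs_gates n d)"
proof -
  have "gates_on (base_wires n \<union> (\<Union>l\<in>{..d}. Reach l ` {1..n})) (reach_gates n l v)"
    if "l < d" "v \<in> {1..n}" for l v
  proof (rule gates_on_mono[OF gates_on_reach_gates[OF that(2)]])
    have "Reach l ` {1..n} \<subseteq> (\<Union>l\<in>{..d}. Reach l ` {1..n})" using that by (intro UN_upper) simp
    moreover have "Reach (Suc l) v \<in> (\<Union>l\<in>{..d}. Reach l ` {1..n})"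
      using that by (intro UN_I[of "Suc l"]) auto
    ultimately show "base_wires n \<union> Reach l ` {1..n} \<union> {Reach (Suc l) v} \<subseteq>
      base_wires n \<union> (\<Union>l\<in>{..d}. Reach l ` {1..n})" by blast
  qed
  then show ?thesis by (auto simp: bfs_gates_def simp del: upt_Suc)
qed

text \<open>No control is an \<open>Arrive\<close> wire, so no gate reads the result of another and
  all of them see the initial values.\<close>

lemma run_arrive_gates:
  assumes "distinct us" "\<And>u. u \<in> set us \<Longrightarrow> set (cs u) \<inter> range Arrive = {}"
  shows "run_gates (map (\<lambda>u. (cs u, Arrive u)) us) s =
    (\<lambda>w. case w of Arrive u \<Rightarrow> if u \<in> set us then s w \<noteq> (\<forall>c\<in>set (cs u). s c) else s w | _ \<Rightarrow> s w)"
  using assms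
proof (induction us arbitrary: s)
  case Nil
  then show ?case by (auto simp: fun_eq_iff split: wire.splits)
next
  case (Cons u us)
  define s' where "s' = gate_act (cs u, Arrive u) s"
  have s': "s' c = s c" if "c \<in> set (cs u')" "u' \<in> set (u # us)" for c u'
    using Cons.prems(2)[OF that(2)] that(1) by (auto simp: s'_def gate_act_def)
  have "run_gates (map (\<lambda>u. (cs u, Arrive u)) us) s' =
    (\<lambda>w. case w of Arrive u \<Rightarrow> if u \<in> set us then s' w \<noteq> (\<forall>c\<in>set (cs u). s' c) else s' w | _ \<Rightarrow> s' w)"
    using Cons.prems by (intro Cons.IH) auto
  also have "\<dots> = (\<lambda>w. case w of Arrive u' \<Rightarrow>
      if u' \<in> set (u # us) then s w \<noteq> (\<forall>c\<in>set (cs u'). s c) else s w | _ \<Rightarrow> s w)"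
    using Cons.prems(1) s' by (auto simp: fun_eq_iff s'_def gate_act_def split: wire.splits)
  finally show ?case by (simp add: s'_def)
qed

lemma run_reach_gates:
  assumes "v \<in> {1..n}" "\<And>u. \<not> s (Arrive u)" "\<And>i. \<not> s (Conj i)"
  shows "run_gates (reach_gates n l v) s = s(Reach (Suc l) v := (s (Reach (Suc l) v) \<noteq>
    (\<exists>u\<in>{1..n}. s (Reach l u) \<and> (u = v \<or> s (Adj (pair_index n u v))))))"
proof -
  define s' where "s' = run_gates (map (\<lambda>u. (if u = v then [Reach l u]
    else [Reach l u, Adj (pair_index n u v)], Arrive u)) [1..<Suc n]) s"
  have s': "s' = (\<lambda>w. case w of Arrive u \<Rightarrow> if u \<in> {1..n} then s (Reach l u) \<and> (u = v \<or> s (Adj (pair_index n u v)))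
      else False | _ \<Rightarrow> s w)"
    unfolding s'_def using assms(2)
    by (subst run_arrive_gates) (auto simp: fun_eq_iff split: wire.splits simp del: upt_Suc)
  let ?ls = "map (\<lambda>u. (Arrive u, False)) [1..<Suc n]"
  have "run_gates (conj_gates ?ls) s' (Conj (length ?ls)) \<longleftrightarrow> (\<forall>(w, p)\<in>set ?ls. s' w = p)"
    using assms(3) by (intro run_conj_gates) (auto simp: s' simp del: upt_Suc)
  then have "run_gates (reach_compute n l v) s (Conj n) \<longleftrightarrow> (\<forall>(w, p)\<in>set ?ls. s' w = p)"
    unfolding reach_compute_def run_gates_simps s'_def[symmetric] by (simp del: upt_Suc)
  also have "\<dots> \<longleftrightarrow> \<not> (\<exists>u\<in>{1..n}. s (Reach l u) \<and> (u = v \<or> s (Adj (pair_index n u v))))"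
    by (auto simp: s' simp del: upt_Suc)
  finally have c: "run_gates (reach_compute n l v) s (Conj n) \<longleftrightarrow>
    \<not> (\<exists>u\<in>{1..n}. s (Reach l u) \<and> (u = v \<or> s (Adj (pair_index n u v))))" .
  have "run_gates (compute_copy_uncompute (reach_compute n l v) (Conj n) (Reach (Suc l) v)) s =
      s(Reach (Suc l) v := (s (Reach (Suc l) v) \<noteq> run_gates (reach_compute n l v) s (Conj n)))"
    by (rule run_compute_copy_uncompute[OF gates_on_reach_compute[OF assms(1)]])
      (use Conj_in_base_wires(1) in \<open>auto simp: base_wires_def\<close>)
  then show ?thesis unfolding reach_gates_def c by (auto simp: gate_act_def fun_eq_iff)
qed

definition with_reach :: "(wire \<Rightarrow> bool) \<Rightarrow> (nat \<Rightarrow> nat \<Rightarrow> bool) \<Rightarrow> wire \<Rightarrow> bool" where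
  "with_reach s P w = (case w of Reach l v \<Rightarrow> P l v | _ \<Rightarrow> s w)"

lemma with_reach_simps [simp]:
  "with_reach s P (Reach l v) = P l v" "with_reach s P (Adj i) = s (Adj i)"
  "with_reach s P (Arrive u) = s (Arrive u)" "with_reach s P (Conj i) = s (Conj i)"
  "with_reach s P (Pass b) = s (Pass b)" "with_reach s P Target = s Target"
  by (simp_all add: with_reach_def)

text \<open>\<open>V\<close> holds the vertices already treated on level \<open>Suc l\<close>. A
  block of gates takes its values from level \<open>l\<close> and the adjacency bits, so it is
  unaffected by earlier blocks of its level. \<open>Q\<close> is any predicate obeying the recursion
  of the search.\<close>

lemma run_reach_level:
  assumes clean: "\<And>u. \<not> s (Arrive u)" "\<And>i. \<not> s (Conj i)"
    and Q: "\<And>l v. v \<in> {1..n} \<Longrightarrow>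
      Q (Suc l) v \<longleftrightarrow> (\<exists>u\<in>{1..n}. Q l u \<and> (u = v \<or> s (Adj (pair_index n u v))))"
    and "distinct vs" "set vs \<subseteq> {1..n}" "V \<inter> set vs = {}"
  shows "run_gates (concat (map (reach_gates n l) vs))
      (with_reach s (\<lambda>l' v. (l' \<le> l \<or> l' = Suc l \<and> v \<in> V) \<and> Q l' v)) =
    with_reach s (\<lambda>l' v. (l' \<le> l \<or> l' = Suc l \<and> v \<in> V \<union> set vs) \<and> Q l' v)"
  using assms(4-6)
proof (induction vs arbitrary: V)
  case (Cons v vs)
  let ?s = "\<lambda>V. with_reach s (\<lambda>l' v. (l' \<le> l \<or> l' = Suc l \<and> v \<in> V) \<and> Q l' v)"
  have v: "v \<in> {1..n}" "v \<notin> V" using Cons.prems by auto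
  have "run_gates (reach_gates n l v) (?s V) = (?s V)(Reach (Suc l) v := (?s V (Reach (Suc l) v) \<noteq>
      (\<exists>u\<in>{1..n}. ?s V (Reach l u) \<and> (u = v \<or> ?s V (Adj (pair_index n u v))))))"
    by (rule run_reach_gates[OF v(1)]) (simp_all add: clean)
  also have "\<dots> = (?s V)(Reach (Suc l) v := Q (Suc l) v)" using Q[OF v(1), of l] v(2) by simp
  also have "\<dots> = ?s (insert v V)" by (auto simp: fun_eq_iff with_reach_def split: wire.splits)
  finally have "run_gates (concat (map (reach_gates n l) (v # vs))) (?s V) =
      run_gates (concat (map (reach_gates n l) vs)) (?s (insert v V))"
    by (simp only: list.map concat.simps run_gates_simps)
  also have "\<dots> = ?s (insert v V \<union> set vs)" using Cons.prems by (intro Cons.IH) auto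
  finally show ?case by (simp only: list.set Un_insert_left Un_insert_right)
qed simp

text \<open>The hypothesis \<open>range\<close> makes \<open>Q\<close> false on the
  \<open>Reach\<close> wires that the circuit never writes.\<close>

lemma run_bfs_gates:
  assumes clean: "\<And>u. \<not> s (Arrive u)" "\<And>i. \<not> s (Conj i)"
    and Q: "\<And>l v. v \<in> {1..n} \<Longrightarrow>
      Q (Suc l) v \<longleftrightarrow> (\<exists>u\<in>{1..n}. Q l u \<and> (u = v \<or> s (Adj (pair_index n u v))))"
    and range: "\<And>l v. Q l v \<Longrightarrow> v \<in> {1..n}"
  shows "run_gates (bfs_gates n d) (with_reach s (\<lambda>l v. l = 0 \<and> Q l v)) =
    with_reach s (\<lambda>l v. l \<le> d \<and> Q l v)"
proof (induction d)
  case 0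
  then show ?case by (simp add: bfs_gates_def)
next
  case (Suc d)
  have "run_gates (bfs_gates n (Suc d)) (with_reach s (\<lambda>l v. l = 0 \<and> Q l v)) =
      run_gates (concat (map (reach_gates n d) [1..<Suc n])) (with_reach s (\<lambda>l v. l \<le> d \<and> Q l v))"
    using Suc unfolding bfs_gates_def by (simp del: upt_Suc add: upt_Suc_append)
  also have "with_reach s (\<lambda>l v. l \<le> d \<and> Q l v) =
      with_reach s (\<lambda>l v. (l \<le> d \<or> l = Suc d \<and> v \<in> {}) \<and> Q l v)" by simp
  also have "run_gates (concat (map (reach_gates n d) [1..<Suc n])) \<dots> =
      with_reach s (\<lambda>l v. (l \<le> d \<or> l = Suc d \<and> v \<in> {} \<union> set [1..<Suc n]) \<and> Q l v)"
    by (rule run_reach_level[where s = s and n = n and Q = Q, OF clean Q]) (auto simp del: upt_Suc)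
  also have "\<dots> = with_reach s (\<lambda>l v. l \<le> Suc d \<and> Q l v)"
    using range by (intro arg_cong[where f = "with_reach s"] ext) (force simp del: upt_Suc)
  finally show ?case .
qed

section \<open>The oracle circuit and its size\<close>

definition distance_literals :: "nat \<Rightarrow> nat \<Rightarrow> (nat \<Rightarrow> nat \<Rightarrow> nat) \<Rightarrow> nat \<Rightarrow> (wire \<times> bool) list" where
  "distance_literals n m d0 b = (Pass (b - 1), True) #
     map (\<lambda>(l, y). (Reach l y, d0 b y \<le> l)) (List.product [0..<n] [1..<Suc m])"

definition source_compute :: "nat \<Rightarrow> nat \<Rightarrow> (nat \<Rightarrow> nat \<Rightarrow> nat) \<Rightarrow> nat \<Rightarrow> wire cgate list" where
  "source_compute n m d0 b =
     ([], Reach 0 b) # bfs_gates n (n - 1) @ conj_gates (distance_literals n m d0 b)"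

definition source_gates :: "nat \<Rightarrow> nat \<Rightarrow> (nat \<Rightarrow> nat \<Rightarrow> nat) \<Rightarrow> nat \<Rightarrow> wire cgate list" where
  "source_gates n m d0 b = compute_copy_uncompute (source_compute n m d0 b) (Conj (n * m + 1)) (Pass b)"

definition oracle_compute :: "nat \<Rightarrow> nat \<Rightarrow> (nat \<Rightarrow> nat \<Rightarrow> nat) \<Rightarrow> wire cgate list" where
  "oracle_compute n m d0 = ([], Pass 0) # concat (map (source_gates n m d0) [1..<Suc m])"

definition oracle_gates :: "nat \<Rightarrow> nat \<Rightarrow> (nat \<Rightarrow> nat \<Rightarrow> nat) \<Rightarrow> wire cgate list" where
  "oracle_gates n m d0 = compute_copy_uncompute (oracle_compute n m d0) (Pass m) Target"

definition work_wires :: "nat \<Rightarrow> wire set" where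
  "work_wires n = base_wires n \<union> (\<Union>l\<in>{..<n}. Reach l ` {1..n})"

definition distances_match :: "nat \<Rightarrow> nat \<Rightarrow> (nat \<Rightarrow> nat \<Rightarrow> nat) \<Rightarrow> bool list \<Rightarrow> nat \<Rightarrow> bool" where
  "distances_match n m d0 e b \<longleftrightarrow>
     (\<forall>l<n. \<forall>y\<in>{1..m}. graph_dist {1..n} (edges_of n e) b y \<le> enat l \<longleftrightarrow> d0 b y \<le> l)"

lemma length_distance_literals: "length (distance_literals n m d0 b) = n * m + 1"
  by (simp add: distance_literals_def length_product del: upt_Suc)

lemma set_distance_literals:
  "set (distance_literals n m d0 b) =
    insert (Pass (b - 1), True) {(Reach l y, d0 b y \<le> l) |l y. l < n \<and> y \<in> {1..m}}"
  by (force simp: distance_literals_def image_iff simp del: upt_Suc)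

lemma gates_on_source_compute:
  assumes "b \<in> {1..m}" "m \<le> n"
  shows "gates_on (insert (Pass (b - 1)) (work_wires n)) (source_compute n m d0 b)"
proof -
  let ?W = "insert (Pass (b - 1)) (work_wires n)"
  have n: "0 < n" using assms by auto
  have "gates_on ?W (bfs_gates n (n - 1))"
  proof (rule gates_on_mono[OF gates_on_bfs_gates])
    have "{..n - 1} = {..<n}" using n by auto
    then show "base_wires n \<union> (\<Union>l\<in>{..n - 1}. Reach l ` {1..n}) \<subseteq> ?W"
      unfolding work_wires_def by auto
  qed
  moreover have "gates_on ?W (conj_gates (distance_literals n m d0 b))"
  proof (rule gates_on_conj_gates)
    show "fst ` set (distance_literals n m d0 b) \<inter> range Conj = {}"
      unfolding set_distance_literals by auto
    show "fst ` set (distance_literals n m d0 b) \<subseteq> ?W"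
      unfolding set_distance_literals work_wires_def using assms by fastforce
    have "n * m + 1 \<le> n * n + 1" using assms(2) by simp
    then have "Conj ` {..n * m + 1} \<subseteq> Conj ` {..n * n + 1}" by (intro image_mono) simp
    then show "Conj ` {..length (distance_literals n m d0 b)} \<subseteq> ?W"
      unfolding length_distance_literals work_wires_def base_wires_def by blast
  qed
  moreover have "Reach 0 b \<in> ?W" using n assms unfolding work_wires_def by force
  ultimately show ?thesis unfolding source_compute_def by (simp add: cgate_ok_def)
qed

lemma Conj_in_work_wires: "m \<le> n \<Longrightarrow> Conj (n * m + 1) \<in> work_wires n"
proof -
  assume "m \<le> n"
  then have "n * m + 1 \<le> n * n + 1" by simp
  then show ?thesis unfolding work_wires_def base_wires_def by blast
qed

lemma Pass_notin_work_wires: "Pass b \<notin> work_wires n" "Target \<notin> work_wires n"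
  by (auto simp: work_wires_def base_wires_def)

lemma gates_on_source_gates:
  assumes "b \<in> {1..m}" "m \<le> n"
  shows "gates_on (insert (Pass b) (insert (Pass (b - 1)) (work_wires n))) (source_gates n m d0 b)"
  unfolding source_gates_def
  using Conj_in_work_wires[OF assms(2)] Pass_notin_work_wires assms(1)
  by (intro gates_on_compute_copy_uncompute[OF gates_on_source_compute[OF assms]]) auto

lemma gates_on_oracle_compute:
  assumes "m \<le> n"
  shows "gates_on (work_wires n \<union> Pass ` {..m}) (oracle_compute n m d0)"
proof -
  have "gates_on (work_wires n \<union> Pass ` {..m}) (source_gates n m d0 b)" if "b \<in> {1..m}" for b
    by (rule gates_on_mono[OF gates_on_source_gates[OF that assms]]) (use that in auto)
  then show ?thesis unfolding oracle_compute_def by (auto simp: cgate_ok_def simp del: upt_Suc)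
qed

lemma gates_on_oracle_gates:
  assumes "m \<le> n"
  shows "gates_on (insert Target (work_wires n \<union> Pass ` {..m})) (oracle_gates n m d0)"
  unfolding oracle_gates_def using Pass_notin_work_wires
  by (intro gates_on_compute_copy_uncompute[OF gates_on_oracle_compute[OF assms]]) auto

lemma run_source_compute:
  assumes b: "b \<in> {1..m}" "m \<le> n"
    and clean: "\<And>u. \<not> s (Arrive u)" "\<And>i. \<not> s (Conj i)" "\<And>l v. \<not> s (Reach l v)"
    and adj: "\<And>i. i < num_pairs n \<Longrightarrow> s (Adj i) \<longleftrightarrow> e ! i"
  shows "run_gates (source_compute n m d0 b) s (Conj (n * m + 1)) \<longleftrightarrow>
    s (Pass (b - 1)) \<and> distances_match n m d0 e b"
proof -
  \<comment> \<open>The intended content of the wires \<open>Reach l v\<close>. Its recursion is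
    \<open>graph_dist_le_Suc_iff\<close>, and its level 0 is the single bit set by the first
    gate.\<close>
  define Q where "Q l v \<longleftrightarrow> v \<in> {1..n} \<and> graph_dist {1..n} (edges_of n e) b v \<le> enat l" for l v
  have bn: "b \<in> {1..n}" using b by auto
  have edge: "s (Adj (pair_index n u v)) \<longleftrightarrow> {u, v} \<in> edges_of n e"
    if "u \<in> {1..n}" "v \<in> {1..n}" "u \<noteq> v" for u v
    using adj pair_index[OF that] by simp
  have loop: "{v, v} \<notin> edges_of n e" for v
    using edges_of_subset[of n e] by (auto simp: doubleton_eq_iff)
  have Q: "Q (Suc l) v \<longleftrightarrow> (\<exists>u\<in>{1..n}. Q l u \<and> (u = v \<or> s (Adj (pair_index n u v))))"
    if v: "v \<in> {1..n}" for l v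
  proof -
    have "Q (Suc l) v \<longleftrightarrow> Q l v \<or> (\<exists>u\<in>{1..n}. {u, v} \<in> edges_of n e \<and> Q l u)"
      using graph_dist_le_Suc_iff[OF v, of "edges_of n e" b l] v unfolding Q_def by blast
    also have "\<dots> \<longleftrightarrow> (\<exists>u\<in>{1..n}. Q l u \<and> (u = v \<or> s (Adj (pair_index n u v))))"
      using v edge[OF _ v] loop by metis
    finally show ?thesis .
  qed
  have "gate_act ([], Reach 0 b) s = with_reach s (\<lambda>l v. l = 0 \<and> Q l v)"
    using clean(3) bn graph_dist_le_0_iff[OF bn, of "edges_of n e"]
    by (auto simp: fun_eq_iff gate_act_def with_reach_def Q_def split: wire.splits)
  then have "run_gates (source_compute n m d0 b) s =
      run_gates (conj_gates (distance_literals n m d0 b)) (with_reach s (\<lambda>l v. l \<le> n - 1 \<and> Q l v))"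
    using run_bfs_gates[of s n Q "n - 1", OF clean(1,2) Q]
    by (simp add: source_compute_def Q_def)
  moreover have "run_gates (conj_gates (distance_literals n m d0 b))
        (with_reach s (\<lambda>l v. l \<le> n - 1 \<and> Q l v)) (Conj (length (distance_literals n m d0 b))) \<longleftrightarrow>
      (\<forall>(w, p)\<in>set (distance_literals n m d0 b). with_reach s (\<lambda>l v. l \<le> n - 1 \<and> Q l v) w = p)"
    using clean(2) by (intro run_conj_gates) (auto simp: set_distance_literals)
  moreover have "(\<forall>(w, p)\<in>set (distance_literals n m d0 b).
        with_reach s (\<lambda>l v. l \<le> n - 1 \<and> Q l v) w = p) \<longleftrightarrow>
      s (Pass (b - 1)) \<and> (\<forall>l<n. \<forall>y\<in>{1..m}. (l \<le> n - 1 \<and> Q l y) = (d0 b y \<le> l))"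
    unfolding set_distance_literals by fastforce
  moreover have "(\<forall>l<n. \<forall>y\<in>{1..m}. (l \<le> n - 1 \<and> Q l y) = (d0 b y \<le> l)) \<longleftrightarrow> distances_match n m d0 e b"
    unfolding distances_match_def Q_def using b(2) by (intro all_cong ball_cong refl) auto
  ultimately show ?thesis unfolding length_distance_literals by simp
qed

lemma run_oracle_gates:
  assumes mn: "m \<le> n"
    and clean: "\<And>u. \<not> s (Arrive u)" "\<And>i. \<not> s (Conj i)" "\<And>l v. \<not> s (Reach l v)" "\<And>b. \<not> s (Pass b)"
    and adj: "\<And>i. i < num_pairs n \<Longrightarrow> s (Adj i) \<longleftrightarrow> e ! i"
  shows "run_gates (oracle_gates n m d0) s =
    s(Target := (s Target \<noteq> (\<forall>b\<in>{1..m}. distances_match n m d0 e b)))"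
proof -
  \<comment> \<open>The state after \<open>j\<close> terminals. Each block conjoins its result with
    the bit \<open>Pass (b - 1)\<close>, so \<open>Pass i\<close> covers the terminals
    \<open>1, ..., i\<close>, starting from the empty conjunction in \<open>Pass 0\<close>; all
    other wires are back at their initial values.\<close>
  define st where "st j = (\<lambda>w. case w of Pass i \<Rightarrow> i \<le> j \<and> (\<forall>b\<in>{1..i}. distances_match n m d0 e b) | _ \<Rightarrow> s w)" for j
  have init: "gate_act ([], Pass 0) s = st 0"
    using clean(4) by (auto simp: fun_eq_iff gate_act_def st_def split: wire.splits)
  have "run_gates (concat (map (source_gates n m d0) [1..<Suc j])) (st 0) = st j" if "j \<le> m" for j
    using that
  proof (induction j)
    case (Suc j)
    have b: "Suc j \<in> {1..m}" using Suc.prems by simp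
    have "run_gates (source_compute n m d0 (Suc j)) (st j) (Conj (n * m + 1)) \<longleftrightarrow>
        st j (Pass (Suc j - 1)) \<and> distances_match n m d0 e (Suc j)"
      using clean adj by (intro run_source_compute[OF b mn]) (auto simp: st_def)
    then have res: "run_gates (source_compute n m d0 (Suc j)) (st j) (Conj (n * m + 1)) \<longleftrightarrow>
        (\<forall>b\<in>{1..Suc j}. distances_match n m d0 e b)"
      by (simp add: st_def atLeastAtMostSuc_conv conj_commute)
    have "run_gates (source_gates n m d0 (Suc j)) (st j) = (st j)(Pass (Suc j) :=
        (st j (Pass (Suc j)) \<noteq> run_gates (source_compute n m d0 (Suc j)) (st j) (Conj (n * m + 1))))"
      unfolding source_gates_def
      using Conj_in_work_wires[OF mn] Pass_notin_work_wires
      by (intro run_compute_copy_uncompute[OF gates_on_source_compute[OF b mn]]) auto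
    also have "\<dots> = st (Suc j)"
      unfolding res by (auto simp: fun_eq_iff st_def le_Suc_eq split: wire.splits)
    finally show ?case using Suc by (simp add: upt_Suc_append del: upt_Suc)
  qed simp
  from this[of m] have "run_gates (oracle_compute n m d0) s = st m"
    by (simp add: oracle_compute_def init del: upt_Suc)
  moreover have "run_gates (oracle_gates n m d0) s =
      s(Target := (s Target \<noteq> run_gates (oracle_compute n m d0) s (Pass m)))"
    unfolding oracle_gates_def using Pass_notin_work_wires
    by (intro run_compute_copy_uncompute[OF gates_on_oracle_compute[OF mn]]) auto
  ultimately show ?thesis by (simp add: st_def)
qed

text \<open>The threshold \<open>l = d\<close> gives \<open>g \<le> d\<close>, and the threshold at
  the value of \<open>g\<close> then gives \<open>d \<le> g\<close>. The first is among those tested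
  because \<open>d < n\<close>.\<close>

lemma distances_match_iff:
  assumes "\<And>x y. x \<in> {1..m} \<Longrightarrow> y \<in> {1..m} \<Longrightarrow> d0 x y < n"
  shows "(\<forall>b\<in>{1..m}. distances_match n m d0 e b) \<longleftrightarrow> classical_check n m d0 e"
proof -
  have "(\<forall>l<n. g \<le> enat l \<longleftrightarrow> d \<le> l) \<longleftrightarrow> g = enat d" if "d < n" for d g
  proof
    assume *: "\<forall>l<n. g \<le> enat l \<longleftrightarrow> d \<le> l"
    then have "g \<le> enat d" using that by blast
    then obtain k where k: "g = enat k" "k \<le> d" by (cases g) auto
    then show "g = enat d" using *[rule_format, of k] that by auto
  qed simp
  then show ?thesis using assms unfolding distances_match_def classical_check_def by metis
qed

lemma length_concat_map_le:
  assumes "\<And>x. length (f x) \<le> B"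
  shows "length (concat (map f xs)) \<le> length xs * B"
  using assms by (induction xs) (auto simp: add_mono)

text \<open>A vertex on one level costs at most \<open>12 * n\<close> gates, so a search costs
  \<open>12 * n ^ 3\<close> and, with the comparison of distances, \<open>20 * n ^ 3\<close>.
  Uncomputation raises this to 41 per terminal and, applied once more to the whole oracle, stays
  below 100; additive constants are absorbed by \<open>m * n ^ 3 \<ge> 1\<close>.\<close>

lemma length_oracle_gates:
  assumes "1 \<le> m" "m \<le> n"
  shows "length (oracle_gates n m d0) \<le> 100 * (m * n ^ 3)"
proof -
  have n: "1 \<le> n" using assms by simp
  then have n3: "1 \<le> n ^ 3" by simp
  have "length (conj_gates (map (\<lambda>u. (Arrive u, False)) [1..<Suc n])) \<le> 1 + 3 * n"
    using length_conj_gates[of "map (\<lambda>u. (Arrive u, False)) [1..<Suc n]"] by (simp del: upt_Suc)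
  then have reach: "length (reach_compute n l v) \<le> 4 * n + 1" for l v
    by (simp add: reach_compute_def del: upt_Suc)
  have "length (reach_gates n l v) \<le> 2 * (4 * n + 1) + 2" for l v
    using reach[of l v] by (simp add: reach_gates_def length_compute_copy_uncompute)
  then have "length (reach_gates n l v) \<le> 12 * n" for l v by (rule order_trans) (use n in simp)
  then have "length (concat (map (reach_gates n l) [1..<Suc n])) \<le> n * (12 * n)" for l
    using length_concat_map_le[of "reach_gates n l" "12 * n" "[1..<Suc n]"] by (simp del: upt_Suc)
  then have "length (bfs_gates n (n - 1)) \<le> (n - 1) * (n * (12 * n))"
    using length_concat_map_le[of "\<lambda>l. concat (map (reach_gates n l) [1..<Suc n])" "n * (12 * n)" "[0..<n - 1]"]
    by (simp add: bfs_gates_def del: upt_Suc)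
  also have "\<dots> \<le> n * (n * (12 * n))" by (intro mult_right_mono) auto
  also have "\<dots> = 12 * n ^ 3" by (simp add: power3_eq_cube)
  finally have bfs: "length (bfs_gates n (n - 1)) \<le> 12 * n ^ 3" .
  have "n * m * 1 \<le> n * n * n" using assms n by (intro mult_mono) auto
  then have "n * m \<le> n ^ 3" by (simp only: power3_eq_cube mult_1_right)
  then have source: "length (source_compute n m d0 b) \<le> 20 * n ^ 3" for b
    using bfs n3 length_conj_gates[of "distance_literals n m d0 b"]
    by (simp add: source_compute_def length_distance_literals)
  have "length (source_gates n m d0 b) \<le> 2 * (20 * n ^ 3) + 1" for b
    using source[of b] by (simp add: source_gates_def length_compute_copy_uncompute)
  then have "length (source_gates n m d0 b) \<le> 41 * n ^ 3" for b
    by (rule order_trans) (use n3 in simp)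
  then have "length (concat (map (source_gates n m d0) [1..<Suc m])) \<le> m * (41 * n ^ 3)"
    using length_concat_map_le[of "source_gates n m d0" "41 * n ^ 3" "[1..<Suc m]"] by (simp del: upt_Suc)
  moreover have "1 \<le> m * n ^ 3" using mult_mono[OF assms(1) n3] by simp
  ultimately have "length (concat (map (source_gates n m d0) [1..<Suc m])) \<le> 41 * (m * n ^ 3)" "1 \<le> m * n ^ 3"
    by (simp_all only: mult.left_commute)
  moreover have "2 * (a + Suc 0) + 1 \<le> 100 * p" if "a \<le> 41 * p" "1 \<le> p" for a p :: nat
    using that by simp
  ultimately show ?thesis
    unfolding oracle_gates_def oracle_compute_def length_compute_copy_uncompute list.size by blast
qed

section \<open>Circuits as unitary operators\<close>

lemma length_gate_map [simp]: "length (gate_map g b) = length b"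
  by (cases g) auto

lemma length_fold_gate_map [simp]: "length (fold gate_map gs b) = length b"
  by (induction gs arbitrary: b) auto

lemma gate_map_involution:
  assumes "gate_wf (length b) g"
  shows "gate_map g (gate_map g b) = b"
proof (cases g)
  case (NOT t)
  then show ?thesis using assms by simp
next
  case (CNOT c t)
  then show ?thesis using assms by (cases "b ! c") simp_all
next
  case (CCNOT c1 c2 t)
  then show ?thesis using assms by (cases "b ! c1"; cases "b ! c2") simp_all
qed

lemma inj_on_fold_gate_map:
  assumes "\<forall>g\<in>set gs. gate_wf q g"
  shows "inj_on (fold gate_map gs) (bitstrings q)"
proof (rule inj_on_inverseI)
  show "fold gate_map (rev gs) (fold gate_map gs b) = b" if "b \<in> bitstrings q" for b
    using that assms
  proof (induction gs arbitrary: b)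
    case (Cons g gs)
    then have "fold gate_map (rev gs) (fold gate_map gs (gate_map g b)) = gate_map g b"
      by (intro Cons.IH) (auto simp: bitstrings_def)
    then show ?case using Cons.prems by (simp add: gate_map_involution bitstrings_def)
  qed simp
qed

lemma circuit_op_eq:
  assumes "c \<in> bitstrings q"
  shows "circuit_op q gs b c = (if b = fold gate_map gs c then 1 else 0)"
  using assms
proof (induction gs arbitrary: c)
  case Nil
  then show ?case by (simp add: id_op_def)
next
  case (Cons g gs)
  have g: "gate_map g c \<in> bitstrings q" using Cons.prems by (simp add: bitstrings_def)
  have "circuit_op q (g # gs) b c = (\<Sum>d\<in>bitstrings q. if d = gate_map g c then circuit_op q gs b d else 0)"
    by (simp add: mult_op_def gate_op_def if_distrib cong: if_cong)
  also have "\<dots> = circuit_op q gs b (gate_map g c)" using g finite_bitstrings[of q] by simp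
  finally show ?case using Cons.IH[OF g] by simp
qed

text \<open>The matrix is that of a permutation of the basis. Injectivity comes from undoing the
  gates; surjectivity, used for the product in the other order, from finiteness.\<close>

lemma unitary_circuit_op:
  assumes "\<forall>g\<in>set gs. gate_wf q g"
  shows "unitary_op q (circuit_op q gs)"
  unfolding unitary_op_def
proof (intro ballI conjI)
  fix b c assume bc: "b \<in> bitstrings q" "c \<in> bitstrings q"
  define f where "f = fold gate_map gs"
  have inj: "inj_on f (bitstrings q)" unfolding f_def by (rule inj_on_fold_gate_map[OF assms])
  have mem: "f d \<in> bitstrings q" if "d \<in> bitstrings q" for d using that by (simp add: f_def bitstrings_def)
  have surj: "f ` bitstrings q = bitstrings q"
    using inj mem finite_bitstrings[of q] by (intro endo_inj_surj) auto
  have "mult_op q (adjoint_op (circuit_op q gs)) (circuit_op q gs) b c =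
      (\<Sum>d\<in>bitstrings q. if d = f b then (if f b = f c then 1 else 0) else 0)"
    unfolding mult_op_def adjoint_op_def
    using bc by (intro sum.cong refl) (auto simp: circuit_op_eq f_def)
  also have "\<dots> = id_op b c"
    using mem[OF bc(1)] finite_bitstrings[of q] bc inj by (auto simp: id_op_def inj_on_def)
  finally show "mult_op q (adjoint_op (circuit_op q gs)) (circuit_op q gs) b c = id_op b c" .
  obtain d0 where d0: "d0 \<in> bitstrings q" "f d0 = b" using bc(1) surj by (metis imageE)
  have "mult_op q (circuit_op q gs) (adjoint_op (circuit_op q gs)) b c =
      (\<Sum>d\<in>bitstrings q. if d = d0 then (if b = c then 1 else 0) else 0)"
    unfolding mult_op_def adjoint_op_def
    using d0 inj by (intro sum.cong refl) (auto simp: circuit_op_eq f_def inj_on_def)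
  also have "\<dots> = id_op b c" using d0 finite_bitstrings[of q] by (simp add: id_op_def)
  finally show "mult_op q (circuit_op q gs) (adjoint_op (circuit_op q gs)) b c = id_op b c" .
qed

lemma app_circuit_op_ket:
  assumes "c \<in> bitstrings q"
  shows "app_op q (circuit_op q gs) (ket c) = ket (fold gate_map gs c)"
proof
  fix b
  have "fold gate_map gs c \<in> bitstrings q" using assms by (simp add: bitstrings_def)
  then show "app_op q (circuit_op q gs) (ket c) b = ket (fold gate_map gs c) b"
    unfolding app_op_ket[OF assms] circuit_op_eq[OF assms] by (auto simp: ket_def)
qed

lemma quantum_oracle_circuit_op:
  assumes "\<forall>g\<in>set gs. gate_wf (N + 1 + k) g"
    and "\<And>x r. x \<in> bitstrings N \<Longrightarrow> fold gate_map gs (x @ [r] @ replicate k False) =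
      x @ [r \<noteq> (x \<in> T)] @ replicate k False"
  shows "quantum_oracle N T k (circuit_op (N + 1 + k) gs)"
  unfolding quantum_oracle_def
proof (intro conjI ballI allI)
  fix x r assume "x \<in> bitstrings N"
  moreover then have "x @ [r] @ replicate k False \<in> bitstrings (N + 1 + k)"
    by (simp add: bitstrings_def)
  ultimately show "app_op (N + 1 + k) (circuit_op (N + 1 + k) gs) (ket (x @ [r] @ replicate k False)) =
      ket (x @ [r \<noteq> (x \<in> T)] @ replicate k False)"
    using assms(2) by (simp only: app_circuit_op_ket)
qed (rule unitary_circuit_op[OF assms(1)])

section \<open>Placing wires on qubits\<close>

fun to_rgate :: "('w \<Rightarrow> nat) \<Rightarrow> 'w cgate \<Rightarrow> rgate" where
  "to_rgate h ([], t) = NOT (h t)"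
| "to_rgate h ([c], t) = CNOT (h c) (h t)"
| "to_rgate h (c1 # c2 # cs, t) = CCNOT (h c1) (h c2) (h t)"

lemma gate_wf_to_rgate:
  assumes "inj_on h W" "h ` W \<subseteq> {..<q}" "cgate_ok g" "snd g \<in> W" "set (fst g) \<subseteq> W"
  shows "gate_wf q (to_rgate h g)"
  using assms by (cases "(h, g)" rule: to_rgate.cases) (auto simp: cgate_ok_def inj_on_def)

lemma gate_map_to_rgate:
  assumes "cgate_ok g"
  shows "gate_map (to_rgate h g) b = b[h (snd g) := (b ! h (snd g) \<noteq> (\<forall>c\<in>set (fst g). b ! h c))]"
  using assms by (cases "(h, g)" rule: to_rgate.cases) (auto simp: cgate_ok_def)

lemma fold_to_rgate:
  assumes h: "inj_on h W" "h ` W \<subseteq> {..<length b}" and "gates_on W gs"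
    and "\<And>w. w \<in> W \<Longrightarrow> b ! h w = s w" and "w \<in> W"
  shows "fold gate_map (map (to_rgate h) gs) b ! h w = run_gates gs s w"
  using assms(2-4)
proof (induction gs arbitrary: b s)
  case Nil
  then show ?case using assms(5) by simp
next
  case (Cons g gs)
  have g: "cgate_ok g" "snd g \<in> W" "set (fst g) \<subseteq> W" and gs: "gates_on W gs" using Cons.prems by auto
  have "gate_map (to_rgate h g) b ! h v = gate_act g s v" if v: "v \<in> W" for v
  proof -
    have "(\<forall>c\<in>set (fst g). b ! h c) \<longleftrightarrow> (\<forall>c\<in>set (fst g). s c)"
      using g(3) Cons.prems(3) by (intro ball_cong) auto
    moreover have "h v = h (snd g) \<longleftrightarrow> v = snd g" using h(1) v g(2) by (auto simp: inj_on_def)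
    moreover have "h v < length b" "h (snd g) < length b" using Cons.prems(1) v g(2) by auto
    ultimately show ?thesis
      using v g(2) Cons.prems(3) by (auto simp: gate_map_to_rgate[OF g(1)] gate_act_def nth_list_update)
  qed
  then show ?case using Cons.prems(1) gs by (simp add: Cons.IH)
qed

text \<open>Adjacency wires and target have prescribed positions, and the others are numbered
  arbitrarily after them. The numbering is onto \<open>{..<q}\<close>, so the final values of the
  wires determine every bit of the register.\<close>

lemma ex_reversible_circuit:
  fixes W :: "wire set"
  assumes "finite W" "W \<inter> (range Adj \<union> {Target}) = {}"
    and gs: "gates_on (Adj ` {..<N} \<union> {Target} \<union> W) gs"
    and run: "\<And>x r. x \<in> bitstrings N \<Longrightarrow>
      run_gates gs (case_wire (\<lambda>i. x ! i) r (\<lambda>_ _. False) (\<lambda>_. False) (\<lambda>_. False) (\<lambda>_. False)) =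
      case_wire (\<lambda>i. x ! i) (r \<noteq> (x \<in> T)) (\<lambda>_ _. False) (\<lambda>_. False) (\<lambda>_. False) (\<lambda>_. False)"
  shows "\<exists>gs'. (\<forall>g\<in>set gs'. gate_wf (N + 1 + card W) g) \<and> length gs' = length gs \<and>
    quantum_oracle N T (card W) (circuit_op (N + 1 + card W) gs')"
proof -
  define q where "q = N + 1 + card W"
  obtain h0 where h0: "bij_betw h0 W {0..<card W}" using ex_bij_betw_finite_nat[OF assms(1)] by blast
  define h where "h w = (case w of Adj i \<Rightarrow> i | Target \<Rightarrow> N | _ \<Rightarrow> N + 1 + h0 w)" for w
  let ?A = "Adj ` {..<N} \<union> {Target} \<union> W"
  have hW: "h w = N + 1 + h0 w" if "w \<in> W" for w
    using assms(2) that by (auto simp: h_def split: wire.splits)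
  have hA: "h (Adj i) = i" "h Target = N" for i by (simp_all add: h_def)
  have h0W: "h0 w < card W" if "w \<in> W" for w using h0 that by (auto simp: bij_betw_def)
  have img: "h ` ?A = {..<q}"
  proof
    show "h ` ?A \<subseteq> {..<q}" using h0W by (auto simp: hA hW q_def)
    show "{..<q} \<subseteq> h ` ?A"
    proof
      fix i assume i: "i \<in> {..<q}"
      consider "i < N" | "i = N" | "N + 1 \<le> i" by linarith
      then show "i \<in> h ` ?A"
      proof cases
        case 1
        then show ?thesis by (intro image_eqI[of _ _ "Adj i"]) (auto simp: hA)
      next
        case 2
        then show ?thesis by (intro image_eqI[of _ _ Target]) (auto simp: hA)
      next
        case 3
        then have "i - (N + 1) \<in> {0..<card W}" using i by (auto simp: q_def)
        then obtain w where "w \<in> W" "h0 w = i - (N + 1)" using h0 by (metis bij_betw_iff_bijections)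
        then show ?thesis using 3 by (intro image_eqI[of _ _ w]) (auto simp: hW)
      qed
    qed
  qed
  have card: "card ?A = q"
  proof -
    have "card ?A = card (Adj ` {..<N} \<union> {Target}) + card W"
      using assms by (intro card_Un_disjoint) auto
    also have "card (Adj ` {..<N} \<union> {Target}) = card (Adj ` {..<N}) + 1"
      by (subst card_Un_disjoint) auto
    finally show ?thesis by (simp add: q_def card_image inj_on_def)
  qed
  have inj: "inj_on h ?A" using img card assms(1) by (intro eq_card_imp_inj_on) auto
  have wf: "\<forall>g\<in>set (map (to_rgate h) gs). gate_wf q g"
    using gs img by (auto simp: gates_on_def intro!: gate_wf_to_rgate[OF inj])
  have ini: "(x @ [r] @ replicate (card W) False) ! h w =
      case_wire (\<lambda>i. x ! i) r (\<lambda>_ _. False) (\<lambda>_. False) (\<lambda>_. False) (\<lambda>_. False) w"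
    if "x \<in> bitstrings N" "w \<in> ?A" for x r w
    using that(2)
  proof (elim UnE)
    assume "w \<in> W"
    then show ?thesis
      using assms(2) h0W[of w] that(1) by (auto simp: hW bitstrings_def nth_append split: wire.splits)
  qed (use that(1) in \<open>auto simp: hA bitstrings_def nth_append\<close>)
  have "fold gate_map (map (to_rgate h) gs) (x @ [r] @ replicate (card W) False) =
      x @ [r \<noteq> (x \<in> T)] @ replicate (card W) False" if x: "x \<in> bitstrings N" for x r
  proof (rule nth_equalityI)
    show len: "length (fold gate_map (map (to_rgate h) gs) (x @ [r] @ replicate (card W) False)) =
        length (x @ [r \<noteq> (x \<in> T)] @ replicate (card W) False)" by simp
    fix i assume "i < length (fold gate_map (map (to_rgate h) gs) (x @ [r] @ replicate (card W) False))"
    then have "i \<in> h ` ?A" using x unfolding img by (simp add: q_def bitstrings_def)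
    then obtain w where w: "w \<in> ?A" "i = h w" by blast
    have "fold gate_map (map (to_rgate h) gs) (x @ [r] @ replicate (card W) False) ! h w =
        run_gates gs (case_wire (\<lambda>i. x ! i) r (\<lambda>_ _. False) (\<lambda>_. False) (\<lambda>_. False) (\<lambda>_. False)) w"
    proof (rule fold_to_rgate[OF inj _ gs _ w(1)])
      show "h ` ?A \<subseteq> {..<length (x @ [r] @ replicate (card W) False)}"
        unfolding img using x by (simp add: q_def bitstrings_def)
    qed (rule ini[OF x])
    also have "\<dots> = (x @ [r \<noteq> (x \<in> T)] @ replicate (card W) False) ! h w"
      unfolding run[OF x] by (rule ini[OF x w(1), symmetric])
    finally show "fold gate_map (map (to_rgate h) gs) (x @ [r] @ replicate (card W) False) ! i =
      (x @ [r \<noteq> (x \<in> T)] @ replicate (card W) False) ! i" using w(2) by simp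
  qed
  then have "quantum_oracle N T (card W) (circuit_op q (map (to_rgate h) gs))"
    unfolding q_def using wf by (intro quantum_oracle_circuit_op) (simp_all add: q_def)
  then show ?thesis using wf unfolding q_def by (intro exI[of _ "map (to_rgate h) gs"]) simp
qed

text \<open>The four families have at most \<open>2 * n\<^sup>2 + n + m + 3\<close> members. Only
  the \<open>Pass\<close> wires grow with \<open>m\<close>; the terminals share all the
  others.\<close>

lemma finite_card_work_wires:
  assumes "1 \<le> n" "m \<le> n"
  defines "W \<equiv> Arrive ` {1..n} \<union> Conj ` {..n * n + 1} \<union> (\<Union>l\<in>{..<n}. Reach l ` {1..n}) \<union> Pass ` {..m}"
  shows "finite W" "card W \<le> 7 * n\<^sup>2"
proof -
  have "card (\<Union>l\<in>{..<n}. Reach l ` {1..n}) \<le> (\<Sum>l\<in>{..<n}. card (Reach l ` {1..n}))"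
    by (rule card_UN_le) simp
  also have "\<dots> \<le> (\<Sum>l\<in>{..<n}. n)" by (intro sum_mono order_trans[OF card_image_le]) auto
  finally have "card (\<Union>l\<in>{..<n}. Reach l ` {1..n}) \<le> n * n" by simp
  moreover have "card (Arrive ` {1..n}) \<le> n" "card (Conj ` {..n * n + 1}) \<le> n * n + 2"
    "card (Pass ` {..m}) \<le> m + 1"
    by (rule order_trans[OF card_image_le]; simp)+
  ultimately have "card W \<le> n + (n * n + 2) + n * n + (m + 1)"
    unfolding W_def by (intro order_trans[OF card_Un_le] add_mono)
  moreover have "1 \<le> n * n" "n \<le> n * n" using assms(1) by simp_all
  ultimately show "card W \<le> 7 * n\<^sup>2" using assms(2) unfolding power2_eq_square by linarith
qed (simp add: W_def)

text \<open>If some prescribed distance is \<open>n\<close> or more, or there are more terminals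
  than vertices, no solution exists, and the identity is an oracle for the empty set.\<close>

lemma ex_oracle_circuit:
  assumes "1 \<le> n"
  shows "\<exists>k gs. (\<forall>g\<in>set gs. gate_wf (num_pairs n + 1 + k) g) \<and>
    quantum_oracle (num_pairs n) (solutions n m d0) k (circuit_op (num_pairs n + 1 + k) gs) \<and>
    k \<le> 7 * n\<^sup>2 \<and> (1 \<le> m \<longrightarrow> length gs \<le> 100 * (m * n ^ 3))"
proof (cases "m \<le> n \<and> (\<forall>x\<in>{1..m}. \<forall>y\<in>{1..m}. d0 x y < n)")
  case True
  define W where "W = Arrive ` {1..n} \<union> Conj ` {..n * n + 1} \<union> (\<Union>l\<in>{..<n}. Reach l ` {1..n}) \<union> Pass ` {..m}"
  have W: "finite W" "card W \<le> 7 * n\<^sup>2"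
    unfolding W_def using finite_card_work_wires[OF assms] True by blast+
  have "\<exists>gs'. (\<forall>g\<in>set gs'. gate_wf (num_pairs n + 1 + card W) g) \<and>
      length gs' = length (oracle_gates n m d0) \<and>
      quantum_oracle (num_pairs n) (solutions n m d0) (card W) (circuit_op (num_pairs n + 1 + card W) gs')"
  proof (rule ex_reversible_circuit[OF W(1)])
    show "W \<inter> (range Adj \<union> {Target}) = {}" by (auto simp: W_def)
    show "gates_on (Adj ` {..<num_pairs n} \<union> {Target} \<union> W) (oracle_gates n m d0)"
      by (rule gates_on_mono[OF gates_on_oracle_gates])
        (use True in \<open>auto simp: W_def work_wires_def base_wires_def\<close>)
    fix x r assume x: "x \<in> bitstrings (num_pairs n)"
    define s where "s r = case_wire (\<lambda>i. x ! i) r (\<lambda>_ _. False) (\<lambda>_. False) (\<lambda>_. False) (\<lambda>_. False)" for r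
    have "(\<forall>b\<in>{1..m}. distances_match n m d0 x b) \<longleftrightarrow> x \<in> solutions n m d0"
      using distances_match_iff[of m d0 n x] True classical_check_iff[OF x] by blast
    moreover have "run_gates (oracle_gates n m d0) (s r) =
        (s r)(Target := (s r Target \<noteq> (\<forall>b\<in>{1..m}. distances_match n m d0 x b)))"
      using True by (intro run_oracle_gates) (auto simp: s_def)
    ultimately have "run_gates (oracle_gates n m d0) (s r) = s (r \<noteq> (x \<in> solutions n m d0))"
      by (auto simp: fun_eq_iff s_def split: wire.splits)
    then show "run_gates (oracle_gates n m d0)
        (case_wire (\<lambda>i. x ! i) r (\<lambda>_ _. False) (\<lambda>_. False) (\<lambda>_. False) (\<lambda>_. False)) =
      case_wire (\<lambda>i. x ! i) (r \<noteq> (x \<in> solutions n m d0)) (\<lambda>_ _. False) (\<lambda>_. False) (\<lambda>_. False) (\<lambda>_. False)"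
      by (simp only: s_def)
  qed
  then show ?thesis using W(2) length_oracle_gates[of m n d0] True by metis
next
  case False
  have "solutions n m d0 = {}"
  proof (rule ccontr)
    assume "solutions n m d0 \<noteq> {}"
    then obtain e where e: "is_solution {1..m} d0 {1..n} (edges_of n e)" by (auto simp: solutions_def)
    have "d0 x y < n" if "x \<in> {1..m}" "y \<in> {1..m}" for x y
      using graph_dist_less_card[of "{1..n}" "edges_of n e" x y "d0 x y"] e that
      by (simp add: is_solution_def)
    then show False using False is_solution_bound[OF e] by blast
  qed
  then have "quantum_oracle (num_pairs n) (solutions n m d0) 0 (circuit_op (num_pairs n + 1 + 0) [])"
    by (intro quantum_oracle_circuit_op) auto
  then show ?thesis by (intro exI[of _ 0] exI[of _ "[]"]) simp
qed

text \<open>For \<open>n = 1\<close> there are no pairs at all, so a multiple of their number bounds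
  \<open>n\<^sup>2\<close> only from \<open>n = 2\<close> on.\<close>

lemma num_pairs_bounds:
  shows "real (num_pairs n) \<le> real n ^ 2" and "2 \<le> n \<Longrightarrow> real n ^ 2 \<le> 4 * real (num_pairs n)"
proof -
  have "even (n * (n - 1))" by auto
  then have "2 * num_pairs n = n * (n - 1)" by (simp add: num_pairs_def)
  then have "2 * real (num_pairs n) = real (n * (n - 1))" by (metis of_nat_mult of_nat_numeral)
  then have eq: "2 * real (num_pairs n) = real n * (real n - 1)" by (cases n) (auto simp: algebra_simps)
  show "real (num_pairs n) \<le> real n ^ 2"
    using eq by (simp add: power2_eq_square algebra_simps)
  show "real n ^ 2 \<le> 4 * real (num_pairs n)" if "2 \<le> n"
  proof -
    have "real n * 2 \<le> real n * real n" using that by (intro mult_left_mono) auto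
    then show ?thesis using eq by (simp add: power2_eq_square algebra_simps)
  qed
qed

theorem theorem3p1:
  shows
    "(\<forall>n m d0 k U. n \<ge> 1 \<longrightarrow> quantum_oracle (num_pairs n) (solutions n m d0) k U \<longrightarrow>
        (\<forall>\<omega>\<in>set_pmf (algorithm_A n m d0 k U). \<forall>e. fst \<omega> = Some e \<longrightarrow>
           e \<in> bitstrings (num_pairs n) \<and>
           (\<forall>x\<in>{1..m}. \<forall>y\<in>{1..m}. graph_dist {1..n} (edges_of n e) x y = enat (d0 x y))))
     \<and> (\<exists>C::real. \<forall>n m d0 k U. n \<ge> 1 \<longrightarrow>
          quantum_oracle (num_pairs n) (solutions n m d0) k U \<longrightarrow> admits_solution n m d0 \<longrightarrow>
          measure_pmf.prob (algorithm_A n m d0 k U)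
            {\<omega>. finds_solution n m d0 \<omega> \<and> real (queries \<omega>) \<le> C * query_rate (num_pairs n) m} \<ge> 1 / 2)
     \<and> (\<forall>n m d0 k U (\<delta>::real) (M::nat). n \<ge> 1 \<longrightarrow>
          quantum_oracle (num_pairs n) (solutions n m d0) k U \<longrightarrow> admits_solution n m d0 \<longrightarrow>
          0 < \<delta> \<longrightarrow> \<delta> < 1 \<longrightarrow> real M > log 2 (inverse \<delta>) \<longrightarrow>
          measure_pmf.prob (replicate_pmf M (algorithm_A n m d0 k U))
            {\<omega>s. \<exists>\<omega>\<in>set \<omega>s. finds_solution n m d0 \<omega>} > 1 - \<delta>)
     \<and> (\<exists>C::real. \<forall>n m d0. n \<ge> 1 \<longrightarrow>
          (\<exists>k gs. (\<forall>g\<in>set gs. gate_wf (num_pairs n + 1 + k) g) \<and>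
             quantum_oracle (num_pairs n) (solutions n m d0) k (circuit_op (num_pairs n + 1 + k) gs) \<and>
             real (num_pairs n + 1 + k) \<le> C * real n ^ 2 \<and>
             (n \<ge> 2 \<longrightarrow> real (num_pairs n + 1 + k) \<le> C * real (num_pairs n)) \<and>
             (m \<ge> 1 \<longrightarrow> real (length gs) \<le> C * real m * real n ^ 3)))"
proof (intro conjI)
  show "\<forall>n m d0 k U. n \<ge> 1 \<longrightarrow> quantum_oracle (num_pairs n) (solutions n m d0) k U \<longrightarrow>
      (\<forall>\<omega>\<in>set_pmf (algorithm_A n m d0 k U). \<forall>e. fst \<omega> = Some e \<longrightarrow>
         e \<in> bitstrings (num_pairs n) \<and>
         (\<forall>x\<in>{1..m}. \<forall>y\<in>{1..m}. graph_dist {1..n} (edges_of n e) x y = enat (d0 x y)))"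
    using algorithm_A_sound unfolding classical_check_def by blast
  show "\<exists>C::real. \<forall>n m d0 k U. n \<ge> 1 \<longrightarrow>
      quantum_oracle (num_pairs n) (solutions n m d0) k U \<longrightarrow> admits_solution n m d0 \<longrightarrow>
      measure_pmf.prob (algorithm_A n m d0 k U)
        {\<omega>. finds_solution n m d0 \<omega> \<and> real (queries \<omega>) \<le> C * query_rate (num_pairs n) m} \<ge> 1 / 2"
    using algorithm_A_success by blast
  show "\<forall>n m d0 k U (\<delta>::real) (M::nat). n \<ge> 1 \<longrightarrow>
      quantum_oracle (num_pairs n) (solutions n m d0) k U \<longrightarrow> admits_solution n m d0 \<longrightarrow>
      0 < \<delta> \<longrightarrow> \<delta> < 1 \<longrightarrow> real M > log 2 (inverse \<delta>) \<longrightarrow>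
      measure_pmf.prob (replicate_pmf M (algorithm_A n m d0 k U))
        {\<omega>s. \<exists>\<omega>\<in>set \<omega>s. finds_solution n m d0 \<omega>} > 1 - \<delta>"
    using repeated_algorithm_A_success by blast
  show "\<exists>C::real. \<forall>n m d0. n \<ge> 1 \<longrightarrow>
      (\<exists>k gs. (\<forall>g\<in>set gs. gate_wf (num_pairs n + 1 + k) g) \<and>
         quantum_oracle (num_pairs n) (solutions n m d0) k (circuit_op (num_pairs n + 1 + k) gs) \<and>
         real (num_pairs n + 1 + k) \<le> C * real n ^ 2 \<and>
         (n \<ge> 2 \<longrightarrow> real (num_pairs n + 1 + k) \<le> C * real (num_pairs n)) \<and>
         (m \<ge> 1 \<longrightarrow> real (length gs) \<le> C * real m * real n ^ 3))"
  proof (intro exI[of _ "100 :: real"] allI impI)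
    fix n m :: nat and d0 :: "nat \<Rightarrow> nat \<Rightarrow> nat"
    assume n: "1 \<le> n"
    obtain k gs where wf: "\<forall>g\<in>set gs. gate_wf (num_pairs n + 1 + k) g"
      and circ: "quantum_oracle (num_pairs n) (solutions n m d0) k (circuit_op (num_pairs n + 1 + k) gs)"
      and k: "k \<le> 7 * n\<^sup>2" and len: "1 \<le> m \<longrightarrow> length gs \<le> 100 * (m * n ^ 3)"
      using ex_oracle_circuit[OF n, of m d0] by blast
    have k': "real k \<le> 7 * real n ^ 2" using of_nat_mono[OF k, where ?'a = real] by simp
    have "1 \<le> real n ^ 2" using n by simp
    \<comment> \<open>9 is 1 + 1 + 7, for the adjacency qubits, the target and the ancillas. With
      \<open>n\<^sup>2 \<le> 4 * N\<close> this becomes 36 times \<open>N\<close>, below the 100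
      that the gate count dictates.\<close>
    then have q: "real (num_pairs n + 1 + k) \<le> 9 * real n ^ 2" using k' num_pairs_bounds(1)[of n] by linarith
    have "real (length gs) \<le> 100 * real m * real n ^ 3" if "1 \<le> m"
      using of_nat_mono[OF len[rule_format, OF that], where ?'a = real] by simp
    moreover have "real (num_pairs n + 1 + k) \<le> 100 * real (num_pairs n)" if "2 \<le> n"
      using q num_pairs_bounds(2)[OF that] by linarith
    moreover have "real (num_pairs n + 1 + k) \<le> 100 * real n ^ 2" using q by simp
    ultimately show "\<exists>k gs. (\<forall>g\<in>set gs. gate_wf (num_pairs n + 1 + k) g) \<and>
         quantum_oracle (num_pairs n) (solutions n m d0) k (circuit_op (num_pairs n + 1 + k) gs) \<and>
         real (num_pairs n + 1 + k) \<le> 100 * real n ^ 2 \<and>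
         (n \<ge> 2 \<longrightarrow> real (num_pairs n + 1 + k) \<le> 100 * real (num_pairs n)) \<and>
         (m \<ge> 1 \<longrightarrow> real (length gs) \<le> 100 * real m * real n ^ 3)"
      using wf circ by blast
  qed
qed

end
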